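(* Let $H$ be a finite simple graph with maximum degree $\Delta(H)\le 2$, and let $G$ be obtained from $H$ by gluing in vertex-disjoint copies of $K_4$, i.e. there are pairwise disjoint $4$-element subsets $Y_1,\dots,Y_q\subseteq V(H)$ and $G$ has vertex set $V(H)$ and edge set $E(H)\cup\{uv: u\neq v,\ u,v\in Y_j \text{ for some } j\}$. If $H$ contains at most one odd cycle of length greater than $3$, or if $H$ contains at most $3$ triangles, then $\chi(G)\le 4$.
   Context: All graphs are finite and simple. "Cycles of $H$" refers to the cycle components of $H$ (since $\Delta(H)\le 2$, every component is a path or a cycle). *)

theory Defs
  imports Main
begin

definition simple_graph :: "'a set \<Rightarrow> ('a \<Rightarrow> 'a \<Rightarrow> bool) \<Rightarrow> bool" where
  "simple_graph V E \<longleftrightarrow> finite V \<and> (\<forall>u v. E u v \<longrightarrow> u \<in> V \<and> v \<in> V)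
     \<and> (\<forall>u v. E u v \<longrightarrow> E v u) \<and> (\<forall>v. \<not> E v v)"

definition degree :: "('a \<Rightarrow> 'a \<Rightarrow> bool) \<Rightarrow> 'a \<Rightarrow> nat" where
  "degree E v = card {w. E v w}"

definition max_degree_le :: "'a set \<Rightarrow> ('a \<Rightarrow> 'a \<Rightarrow> bool) \<Rightarrow> nat \<Rightarrow> bool" where
  "max_degree_le V E d \<longleftrightarrow> (\<forall>v\<in>V. degree E v \<le> d)"

definition component :: "'a set \<Rightarrow> ('a \<Rightarrow> 'a \<Rightarrow> bool) \<Rightarrow> 'a \<Rightarrow> 'a set" where
  "component V E v = {w \<in> V. E\<^sup>*\<^sup>* v w}"

definition is_cycle_component :: "'a set \<Rightarrow> ('a \<Rightarrow> 'a \<Rightarrow> bool) \<Rightarrow> 'a set \<Rightarrow> bool" where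
  "is_cycle_component V E C \<longleftrightarrow> (\<exists>v\<in>V. C = component V E v) \<and>
     (\<exists>xs. distinct xs \<and> set xs = C \<and> length xs \<ge> 3 \<and>
        (\<forall>i<length xs. \<forall>j<length xs.
            E (xs ! i) (xs ! j) \<longleftrightarrow>
              (j = (i + 1) mod length xs \<or> i = (j + 1) mod length xs)))"

definition triangles :: "'a set \<Rightarrow> ('a \<Rightarrow> 'a \<Rightarrow> bool) \<Rightarrow> 'a set set" where
  "triangles V E = {T. T \<subseteq> V \<and> card T = 3 \<and> (\<forall>u\<in>T. \<forall>w\<in>T. u \<noteq> w \<longrightarrow> E u w)}"

definition proper_colouring :: "'a set \<Rightarrow> ('a \<Rightarrow> 'a \<Rightarrow> bool) \<Rightarrow> nat \<Rightarrow> ('a \<Rightarrow> nat) \<Rightarrow> bool" where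
  "proper_colouring V E k c \<longleftrightarrow> (\<forall>v\<in>V. c v < k) \<and> (\<forall>u v. E u v \<longrightarrow> c u \<noteq> c v)"

definition chromatic_number :: "'a set \<Rightarrow> ('a \<Rightarrow> 'a \<Rightarrow> bool) \<Rightarrow> nat" where
  "chromatic_number V E = (LEAST k. \<exists>c. proper_colouring V E k c)"

definition glue_K4 :: "('a \<Rightarrow> 'a \<Rightarrow> bool) \<Rightarrow> nat \<Rightarrow> (nat \<Rightarrow> 'a set) \<Rightarrow> 'a \<Rightarrow> 'a \<Rightarrow> bool" where
  "glue_K4 E q Y u v \<longleftrightarrow> E u v \<or> (u \<noteq> v \<and> (\<exists>j<q. u \<in> Y j \<and> v \<in> Y j))"

end

theory Submission
  imports Defs "HOL-Library.FuncSet"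
begin

text \<open>
  Suppose first that at most one odd cycle is longer than 3. It suffices to find f :: 'a => bool that
  splits every Y j evenly and for which no vertex has the colour of two of its neighbours: the edges
  inside the classes of f are then a matching, as are the pairs of equally coloured vertices in the
  sets Y j, and the union of two matchings is bipartite, which yields a second bit. To find f, take
  matchings M of H and P of the K4's with f required to separate both. An even cycle has a perfect
  matching, a path or a triangle may miss an endpoint or one vertex. On the long odd cycle C the
  vertices are left unmatched at first; the paths alternating between M and P pair up unmatched
  vertices, so as C is odd, some v in C is not paired with a vertex of C. Now match C - v and choose
  the colour of v different from that of a neighbour.

  If there are at most 3 triangles, then any k cycles together have more than 4 (k - 1) vertices, so
  augmentation as in Hall's theorem turns any transversal of the sets Y j into one that meets every
  cycle. The swaps bring in only vertices of cycles that are not met, so independent transversals stay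
  independent. Deleting a transversal that meets all cycles leaves paths and disjoint triples, which
  can be 3-coloured (the cycle-plus-triangles theorem of Fleischner and Stiebitz). So take any
  transversal that meets every cycle; a colour class of the 3-colouring of the rest is an independent
  transversal; augment it to one that meets every cycle, give it the fourth colour and 3-colour the
  rest.

  The 3-colouring is found algebraically. Colour with the nonzero elements of GF(4) and sum over all
  colourings c that are injective on the triples the product of c 0 and all c (i - 1) + c i. Expanding
  each factor amounts to orienting the path, and the sum over the colourings of a triple is 1 if its
  indegrees are 0, 1, 2 and 0 otherwise, so the sum is the parity of the number of such orientations.
  These are the solutions of a system of quadratic equations over F2, one of which is redundant, and
  an argument as for the Chevalley-Warning theorem shows that their number is odd.
\<close>

section \<open>The field with four elements\<close>

datatype gf4 = G0 | G1 | Ga | Gb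

instantiation gf4 :: comm_ring_1
begin

definition zero_gf4 :: gf4 where "0 = G0"
definition one_gf4 :: gf4 where "1 = G1"

fun plus_gf4 :: "gf4 \<Rightarrow> gf4 \<Rightarrow> gf4" where
  "G0 + y = y"
| "x + G0 = x"
| "G1 + Ga = Gb" | "Ga + G1 = Gb"
| "G1 + Gb = Ga" | "Gb + G1 = Ga"
| "Ga + Gb = G1" | "Gb + Ga = G1"
| "G1 + G1 = G0" | "Ga + Ga = G0" | "Gb + Gb = G0"

fun times_gf4 :: "gf4 \<Rightarrow> gf4 \<Rightarrow> gf4" where
  "G0 * y = G0"
| "x * G0 = G0"
| "G1 * y = y"
| "x * G1 = x"
| "Ga * Ga = Gb" | "Ga * Gb = G1" | "Gb * Ga = G1" | "Gb * Gb = Ga"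

definition uminus_gf4 :: "gf4 \<Rightarrow> gf4" where "- x = (x::gf4)"
definition minus_gf4 :: "gf4 \<Rightarrow> gf4 \<Rightarrow> gf4" where "x - y = x + (y::gf4)"

instance
proof
  fix x y z :: gf4
  show "x + y + z = x + (y + z)" by (cases x; cases y; cases z; simp)
  show "x + y = y + x" by (cases x; cases y; simp)
  show "0 + x = x" by (cases x; simp add: zero_gf4_def)
  show "- x + x = 0" by (cases x; simp add: zero_gf4_def uminus_gf4_def)
  show "x - y = x + - y" by (simp add: minus_gf4_def uminus_gf4_def)
  show "x * y * z = x * (y * z)" by (cases x; cases y; cases z; simp)
  show "x * y = y * x" by (cases x; cases y; simp)
  show "1 * x = x" by (cases x; simp add: one_gf4_def)
  show "(x + y) * z = x * z + y * z" by (cases x; cases y; cases z; simp)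
  show "(0::gf4) \<noteq> 1" by (simp add: zero_gf4_def one_gf4_def)
qed

end

lemma UNIV_gf4: "(UNIV :: gf4 set) = {G0, G1, Ga, Gb}"
  by (rule UNIV_eq_I) (case_tac x; simp)

instance gf4 :: finite
  by standard (simp add: UNIV_gf4)

lemma gf4_add_self [simp]: "x + x = (0::gf4)"
  by (cases x; simp add: zero_gf4_def)

lemma gf4_add_eq_0_iff: "x + y = 0 \<longleftrightarrow> x = (y::gf4)"
  by (cases x; cases y; simp add: zero_gf4_def)

lemma of_nat_gf4: "(of_nat n :: gf4) = of_bool (odd n)"
  by (induction n) auto

lemma gf4_two [simp]: "2 = (0::gf4)"
  by (metis one_add_one gf4_add_self)

lemma of_nat_card_gf4 [simp]: "of_nat (card (UNIV::gf4 set)) = (0::gf4)"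
  by (simp add: UNIV_gf4 of_nat_gf4)

text \<open>Takes the place of the vanishing power sums in a Chevalley-Warning argument: a variable
  on which a term depends additively is summed out to 0. As \<open>Gb\<close> is
  \<open>G1 + Ga\<close>, every value occurs twice.\<close>

lemma sum_additive_gf4:
  fixes L :: "gf4 \<Rightarrow> gf4"
  assumes "\<And>u v. L (u + v) = L u + L v"
  shows "(\<Sum>v\<in>UNIV. L v) = 0"
proof -
  have "L G0 = 0" using assms[of 0 0] by (simp flip: zero_gf4_def)
  moreover have "L Gb = L G1 + L Ga" using assms[of G1 Ga] by simp
  ultimately show ?thesis
    by (simp add: UNIV_gf4)
qed

lemma sum_bit_gf4:
  fixes f :: "'i \<Rightarrow> gf4"
  assumes "\<And>s. s \<in> A \<Longrightarrow> f s \<in> {0, 1}"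
  shows "sum f A \<in> {0, 1}"
  using assms
proof (induction A rule: infinite_finite_induct)
  case (insert a A)
  hence "sum f A \<in> {0, 1}" "f a \<in> {0, 1}" by simp_all
  thus ?case using insert.hyps by auto
qed auto

text \<open>Off-diagonal terms cancel in pairs in characteristic 2. This relation makes one equation
  of the system redundant.\<close>

lemma sum_symmetric_gf4:
  fixes h :: "'i \<Rightarrow> 'i \<Rightarrow> gf4"
  assumes "finite S" and "\<And>s t. h s t = h t s" and "\<And>t. h t t = 0"
  shows "(\<Sum>s\<in>S. \<Sum>t\<in>S. h s t) = 0"
  using assms(1)
proof (induction S rule: finite_induct)
  case (insert a S)
  have "(\<Sum>s\<in>insert a S. \<Sum>t\<in>insert a S. h s t)
      = (\<Sum>t\<in>S. h a t) + (\<Sum>s\<in>S. h s a) + (\<Sum>s\<in>S. \<Sum>t\<in>S. h s t)"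
    using insert by (simp add: sum.distrib assms(3) add.assoc)
  also have "(\<Sum>s\<in>S. h s a) = (\<Sum>t\<in>S. h a t)"
    by (rule sum.cong) (use assms(2) in auto)
  finally show ?case using insert.IH by simp
qed simp

section \<open>Solutions of a quadratic system\<close>

definition supported :: "'i set \<Rightarrow> ('i \<Rightarrow> gf4) set" where
  "supported W = {x. \<forall>t. t \<notin> W \<longrightarrow> x t = 0}"

lemma finite_supported: "finite W \<Longrightarrow> finite (supported W)"
  unfolding supported_def
  using finite_set_of_finite_funs[of W "UNIV::gf4 set" 0] by simp

lemma sum_supported_remove:
  fixes \<phi> :: "('i \<Rightarrow> gf4) \<Rightarrow> gf4"
  assumes "r \<in> W"
  shows "sum \<phi> (supported W) = (\<Sum>x\<in>supported (W - {r}). \<Sum>v\<in>UNIV. \<phi> (x(r := v)))"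
proof -
  have "sum \<phi> (supported W) = (\<Sum>(x, v)\<in>supported (W - {r}) \<times> UNIV. \<phi> (x(r := v)))"
    by (rule sum.reindex_bij_witness[where i = "\<lambda>(x, v). x(r := v)" and j = "\<lambda>x. (x(r := 0), x r)"])
      (use assms in \<open>auto simp: supported_def fun_eq_iff\<close>)
  thus ?thesis by (simp add: sum.cartesian_product)
qed

text \<open>A block is one \<open>gf4\<close> variable, read as two bits. The forms
  \<open>B s t\<close> are F2-bilinear with values in F2, and by \<open>B_diag\<close> no block is
  paired with itself.\<close>

locale block_form =
  fixes S :: "'i set" and B :: "'i \<Rightarrow> 'i \<Rightarrow> gf4 \<Rightarrow> gf4 \<Rightarrow> gf4"
  assumes finite_S: "finite S"
    and B_add: "B s t (u + u') v = B s t u v + B s t u' v"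
    and B_sym: "B s t u v = B t s v u"
    and B_diag: "B t t u v = 0"
    and B_bit: "B s t u v \<in> {0, 1}"
begin

lemma B_add2: "B s t u (v + v') = B s t u v + B s t u v'"
  by (metis B_add B_sym)

lemma B_zero [simp]: "B s t 0 v = 0" "B s t u 0 = 0"
  using B_add[of s t 0 0 v] B_add2[of s t u 0 0] by simp_all

text \<open>One quadratic equation per block, hence total degree \<open>2 * card S\<close> in
  \<open>2 * card S\<close> bits: one equation too many for Chevalley-Warning, which the symmetry of
  \<open>B\<close> makes up for.\<close>

definition R :: "'i \<Rightarrow> ('i \<Rightarrow> gf4) \<Rightarrow> gf4" where
  "R t x = (\<Sum>s\<in>S. B t s (x t) (x s))"

lemma R_bit: "R t x \<in> {0, 1}"
  unfolding R_def by (rule sum_bit_gf4) (rule B_bit)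

text \<open>Expand both the product and the forms; since fewer than card W forms are multiplied,
  each summand contains some block at most linearly, and summing over that block gives 0.\<close>

lemma sum_prod_R_eq_0:
  assumes "W \<subseteq> S" "U \<subseteq> W" "card U < card W"
  shows "(\<Sum>x\<in>supported W. \<Prod>t\<in>U. R t x) = 0"
proof -
  have fin: "finite W" "finite U" using assms finite_S finite_subset by metis+
  have R: "R t x = (\<Sum>s\<in>W. B t s (x t) (x s))" if "x \<in> supported W" for t x
    unfolding R_def using that finite_S assms(1)
    by (intro sum.mono_neutral_right) (auto simp: supported_def)
  have zero: "(\<Sum>x\<in>supported W. \<Prod>t\<in>U. B t (\<pi> t) (x t) (x (\<pi> t))) = 0"
    if "\<pi> \<in> PiE U (\<lambda>_. W)" for \<pi>
  proof -
    \<comment> \<open>\<open>N r\<close> counts the occurrences of block \<open>r\<close> in the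
      product, as either argument. They total \<open>2 * card U < 2 * card W\<close>, so some
      \<open>r\<close> in \<open>W\<close> occurs at most once.\<close>
    define N where "N r = card {t \<in> U. t = r} + card {t \<in> U. \<pi> t = r}" for r
    have fibres: "(\<Sum>r\<in>W. card {t \<in> U. f t = r}) = card U" if "f ` U \<subseteq> W" for f
      using sum.group[OF fin(2) fin(1) that, of "\<lambda>_. 1::nat"] by simp
    have "(\<Sum>r\<in>W. card {t \<in> U. t = r}) = card U"
      using fibres[of "\<lambda>t. t"] assms(2) by simp
    moreover have "(\<Sum>r\<in>W. card {t \<in> U. \<pi> t = r}) = card U"
      using fibres[of \<pi>] that by (auto simp: PiE_iff)
    ultimately have sumN: "(\<Sum>r\<in>W. N r) = 2 * card U"
      by (simp add: N_def sum.distrib)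
    have "\<exists>r\<in>W. N r \<le> 1"
    proof (rule ccontr)
      assume "\<not> ?thesis"
      hence "(\<Sum>r\<in>W. 2) \<le> (\<Sum>r\<in>W. N r)" by (intro sum_mono) force
      thus False using sumN assms(3) by simp
    qed
    then obtain r where r: "r \<in> W" "N r \<le> 1" by blast
    have "(\<Sum>v\<in>UNIV. \<Prod>t\<in>U. B t (\<pi> t) ((x(r := v)) t) ((x(r := v)) (\<pi> t))) = 0" for x
    proof (cases "\<exists>t\<in>U. t = r \<or> \<pi> t = r")
      case False
      \<comment> \<open>Block \<open>r\<close> does not occur, so four equal terms are added, which
        gives 0.\<close>
      hence "(\<Prod>t\<in>U. B t (\<pi> t) ((x(r := v)) t) ((x(r := v)) (\<pi> t)))
          = (\<Prod>t\<in>U. B t (\<pi> t) (x t) (x (\<pi> t)))" for v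
        by (intro prod.cong) auto
      thus ?thesis by simp
    next
      case True
      then obtain q where q: "q \<in> U" "q = r \<or> \<pi> q = r" by blast
      \<comment> \<open>The factor \<open>q\<close> is the only one containing block
        \<open>r\<close>, and by \<open>nqr\<close> in just one argument, so the product is additive
        in the value \<open>v\<close> of that block.\<close>
      have other: "t = q" if "t \<in> U" "t = r \<or> \<pi> t = r" for t
      proof (rule ccontr)
        assume "t \<noteq> q"
        have *: "card A \<ge> 1" if "a \<in> A" "A \<subseteq> U" for a A
          using that fin(2) finite_subset by (metis One_nat_def Suc_leI card_gt_0_iff empty_iff)
        show False
        proof (cases "\<pi> t = r \<and> \<pi> q = r")
          case True
          hence "card {t, q} \<le> card {t \<in> U. \<pi> t = r}"
            using that q fin by (intro card_mono) auto
          thus False using \<open>t \<noteq> q\<close> r(2) by (simp add: N_def)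
        next
          case False
          hence "r \<in> {t \<in> U. t = r}" "\<exists>a. a \<in> {t \<in> U. \<pi> t = r}" using that q \<open>t \<noteq> q\<close> by auto
          then obtain a where "r \<in> {t \<in> U. t = r}" "a \<in> {t \<in> U. \<pi> t = r}" by blast
          hence "card {t \<in> U. t = r} \<ge> 1" "card {t \<in> U. \<pi> t = r} \<ge> 1"
            by (metis (no_types, lifting) * mem_Collect_eq subsetI)+
          thus False using r(2) unfolding N_def by linarith
        qed
      qed
      have nqr: "\<not> (q = r \<and> \<pi> q = r)"
      proof
        assume a: "q = r \<and> \<pi> q = r"
        have "card {q} \<le> card {t \<in> U. t = r}" using a q fin by (intro card_mono) auto
        moreover have "card {q} \<le> card {t \<in> U. \<pi> t = r}" using a q fin by (intro card_mono) auto
        ultimately show False using r(2) by (simp add: N_def)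
      qed
      define c where "c = (\<Prod>t\<in>U - {q}. B t (\<pi> t) (x t) (x (\<pi> t)))"
      have split: "(\<Prod>t\<in>U. B t (\<pi> t) ((x(r := v)) t) ((x(r := v)) (\<pi> t)))
          = B q (\<pi> q) ((x(r := v)) q) ((x(r := v)) (\<pi> q)) * c" for v
      proof -
        have "(\<Prod>t\<in>U - {q}. B t (\<pi> t) ((x(r := v)) t) ((x(r := v)) (\<pi> t))) = c"
          unfolding c_def using other by (intro prod.cong) auto
        thus ?thesis using prod.remove[OF fin(2) q(1)] by metis
      qed
      have "(\<Sum>v\<in>UNIV. B q (\<pi> q) ((x(r := v)) q) ((x(r := v)) (\<pi> q))) = 0"
        using q(2) nqr by (intro sum_additive_gf4) (auto simp: B_add B_add2)
      thus ?thesis unfolding split by (simp flip: sum_distrib_right)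
    qed
    thus ?thesis using r(1) by (simp add: sum_supported_remove del: fun_upd_apply)
  qed
  have "(\<Sum>x\<in>supported W. \<Prod>t\<in>U. R t x)
      = (\<Sum>x\<in>supported W. \<Prod>t\<in>U. \<Sum>s\<in>W. B t s (x t) (x s))"
    using R by simp
  also have "\<dots> = (\<Sum>x\<in>supported W. \<Sum>\<pi>\<in>PiE U (\<lambda>_. W). \<Prod>t\<in>U. B t (\<pi> t) (x t) (x (\<pi> t)))"
    using fin by (simp add: prod_sum_PiE)
  also have "\<dots> = 0" using zero by (subst sum.swap) simp
  finally show ?thesis .
qed

text \<open>The indicator of a solution is the product of \<open>1 + R t x\<close>. With the
  equation of one block \<open>w\<close> of \<open>W\<close> left out, each term of its expansion
  multiplies fewer than \<open>card W\<close> forms and sums to 0.\<close>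

lemma even_card_solutions:
  assumes "W \<subseteq> S" "W \<noteq> {}"
  shows "even (card {x \<in> supported W. \<forall>t\<in>S. R t x = 0})"
proof -
  have fin: "finite W" using assms finite_S finite_subset by metis
  obtain w where w: "w \<in> W" using assms by blast
  let ?U = "W - {w}"
  \<comment> \<open>Blocks outside \<open>W\<close> satisfy their equations trivially, and all
    equations sum to 0 by symmetry, so the equation at \<open>w\<close> follows from those in
    \<open>?U\<close>.\<close>
  have total: "(\<Sum>t\<in>S. R t x) = 0" for x
    unfolding R_def by (rule sum_symmetric_gf4) (auto simp: finite_S B_diag intro: B_sym)
  have out: "R t x = 0" if "x \<in> supported W" "t \<notin> W" for t x
    using that by (simp add: R_def supported_def)
  have iff: "(\<forall>t\<in>S. R t x = 0) \<longleftrightarrow> (\<forall>t\<in>?U. R t x = 0)" if x: "x \<in> supported W" for x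
  proof
    assume U: "\<forall>t\<in>?U. R t x = 0"
    have "(\<Sum>t\<in>S. R t x) = R w x"
      using w assms(1) U out[OF x] finite_S by (subst sum.remove[of _ w]) (auto intro!: sum.neutral)
    hence "R w x = 0" using total by simp
    with U show "\<forall>t\<in>S. R t x = 0" using out[OF x] by blast
  qed (use assms in auto)
  have prod: "(\<Prod>t\<in>?U. 1 + R t x) = of_bool (\<forall>t\<in>S. R t x = 0)" if x: "x \<in> supported W" for x
  proof (cases "\<forall>t\<in>?U. R t x = 0")
    case False
    then obtain t where "t \<in> ?U" "R t x \<noteq> 0" by blast
    hence "1 + R t x = 0" using R_bit[of t x] by auto
    hence "(\<Prod>t\<in>?U. 1 + R t x) = 0" using \<open>t \<in> ?U\<close> fin by (intro prod_zero) auto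
    thus ?thesis using False iff[OF x] by simp
  qed (use iff[OF x] in simp)
  have "of_nat (card {x \<in> supported W. \<forall>t\<in>S. R t x = 0})
      = (\<Sum>x\<in>supported W. of_bool (\<forall>t\<in>S. R t x = 0) :: gf4)"
    using finite_supported[OF fin] by (simp add: Int_def)
  also have "\<dots> = (\<Sum>x\<in>supported W. \<Prod>t\<in>?U. 1 + R t x)"
    using prod by simp
  also have "\<dots> = (\<Sum>x\<in>supported W. \<Sum>U\<in>Pow ?U. \<Prod>t\<in>?U - U. R t x)"
    using fin by (simp add: prod_add)
  also have "\<dots> = (\<Sum>U\<in>Pow ?U. \<Sum>x\<in>supported W. \<Prod>t\<in>?U - U. R t x)"
    by (rule sum.swap)
  also have "\<dots> = 0"
  proof (rule sum.neutral, rule ballI)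
    fix U assume "U \<in> Pow ?U"
    have "card (?U - U) < card W"
      using w fin by (intro psubset_card_mono) auto
    thus "(\<Sum>x\<in>supported W. \<Prod>t\<in>?U - U. R t x) = 0"
      using assms(1) by (intro sum_prod_R_eq_0) auto
  qed
  finally show ?thesis by (simp add: of_nat_gf4)
qed

text \<open>Group the solutions supported in a nonempty \<open>W\<close> by exact support. Their
  number is even, and an odd number of proper subsets contribute an odd number each, so an odd
  number is left for \<open>W\<close>.\<close>

theorem odd_card_full_support:
  assumes "W \<subseteq> S"
  shows "odd (card {x. (\<forall>t. x t \<noteq> 0 \<longleftrightarrow> t \<in> W) \<and> (\<forall>t\<in>S. R t x = 0)})"
proof -
  have "finite W" using assms finite_S finite_subset by metis
  thus ?thesis using assms
  proof (induction W rule: finite_psubset_induct)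
    case (psubset W)
    define f where "f U = {x. (\<forall>t. x t \<noteq> 0 \<longleftrightarrow> t \<in> U) \<and> (\<forall>t\<in>S. R t x = 0)}" for U
    have fin_f: "finite (f U)" if "U \<subseteq> W" for U
      using finite_supported[OF psubset.hyps] that
      by (rule_tac finite_subset[of _ "supported W"]) (auto simp: f_def supported_def)
    have IH: "odd (card (f U))" if "U \<subset> W" for U
      using psubset.IH[OF that] psubset.prems that by (auto simp: f_def)
    show ?case
    proof (cases "W = {}")
      case True
      have "f W = {\<lambda>_. 0}" using True by (auto simp: f_def R_def fun_eq_iff)
      thus ?thesis by (simp add: f_def)
    next
      case False
      have "{x \<in> supported W. \<forall>t\<in>S. R t x = 0} = (\<Union>U\<in>Pow W. f U)"
      proof safe
        fix x assume "x \<in> supported W" "\<forall>t\<in>S. R t x = 0"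
        hence "x \<in> f {t. x t \<noteq> 0}" "{t. x t \<noteq> 0} \<in> Pow W" by (auto simp: f_def supported_def)
        thus "x \<in> (\<Union>U\<in>Pow W. f U)" by blast
      qed (auto simp: f_def supported_def)
      also have "card \<dots> = (\<Sum>U\<in>Pow W. card (f U))"
        using psubset.hyps fin_f by (intro card_UN_disjoint) (auto simp: f_def)
      also have "\<dots> = card (f W) + (\<Sum>U\<in>Pow W - {W}. card (f U))"
        using psubset.hyps by (subst sum.remove[of _ W]) auto
      finally have "even (card (f W) + (\<Sum>U\<in>Pow W - {W}. card (f U)))"
        using even_card_solutions[OF psubset.prems False] by simp
      moreover have "odd (\<Sum>U\<in>Pow W - {W}. card (f U))"
      proof -
        have "{U \<in> Pow W - {W}. odd (card (f U))} = Pow W - {W}" using IH by auto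
        moreover have "odd (card (Pow W - {W}))"
          using psubset.hyps False by (simp add: card_Pow)
        ultimately show ?thesis using psubset.hyps by (subst even_sum_iff) auto
      qed
      ultimately show ?thesis by (simp add: f_def)
    qed
  qed
qed

end

section \<open>Colouring a path with triples\<close>

text \<open>Choosing a summand in the factor \<open>x (i - 1) + x i\<close> orients edge
  \<open>i\<close> of the path towards the chosen end; the exponent of \<open>x p\<close> is then
  the indegree of \<open>p\<close>.\<close>

lemma prod_path_orientations:
  fixes x :: "nat \<Rightarrow> 'a::comm_ring_1"
  shows "(\<Prod>i<N. if i = 0 then x 0 else x (i - 1) + x i)
    = (\<Sum>b\<in>PiE {..<N} (\<lambda>i. if i = 0 then {False} else UNIV).
        \<Prod>p<N. x p ^ (of_bool (\<not> b p) + of_bool (Suc p < N \<and> b (Suc p))))"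
proof -
  let ?B = "\<lambda>i::nat. if i = 0 then {False} else UNIV"
  have "(\<Prod>i<N. if i = 0 then x 0 else x (i - 1) + x i)
      = (\<Prod>i<N. \<Sum>e\<in>?B i. if e then x (i - 1) else x i)"
    by (intro prod.cong) (auto simp: UNIV_bool)
  also have "\<dots> = (\<Sum>b\<in>PiE {..<N} ?B. \<Prod>i<N. if b i then x (i - 1) else x i)"
    by (rule prod_sum_PiE) auto
  also have "\<dots> = (\<Sum>b\<in>PiE {..<N} ?B. \<Prod>p<N. x p ^ (of_bool (\<not> b p) + of_bool (Suc p < N \<and> b (Suc p))))"
  proof (intro sum.cong refl)
    fix b assume b: "b \<in> PiE {..<N} ?B"
    have "(\<Prod>i<N. if b i then x (i - 1) else 1) = (\<Prod>p<N. if Suc p < N \<and> b (Suc p) then x p else 1)"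
    proof (cases N)
      case (Suc M)
      have "b 0 = False" using PiE_mem[OF b, of 0] Suc by simp
      thus ?thesis unfolding Suc
        by (subst prod.lessThan_Suc_shift, subst prod.lessThan_Suc) (auto intro!: prod.cong)
    qed simp
    moreover have "(\<Prod>i<N. if b i then x (i - 1) else x i)
        = (\<Prod>i<N. if b i then 1 else x i) * (\<Prod>i<N. if b i then x (i - 1) else 1)"
      by (subst prod.distrib[symmetric]) (auto intro!: prod.cong)
    ultimately have "(\<Prod>i<N. if b i then x (i - 1) else x i)
        = (\<Prod>p<N. (if b p then 1 else x p) * (if Suc p < N \<and> b (Suc p) then x p else 1))"
      by (simp add: prod.distrib)
    also have "\<dots> = (\<Prod>p<N. x p ^ (of_bool (\<not> b p) + of_bool (Suc p < N \<and> b (Suc p))))"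
      by (intro prod.cong) (auto simp: power2_eq_square)
    finally show "(\<Prod>i<N. if b i then x (i - 1) else x i)
        = (\<Prod>p<N. x p ^ (of_bool (\<not> b p) + of_bool (Suc p < N \<and> b (Suc p))))" .
  qed
  finally show ?thesis .
qed

lemmas gf4_unfold = zero_gf4_def one_gf4_def power2_eq_square

definition triples :: "gf4 list set" where
  "triples = {[G1,Ga,Gb], [G1,Gb,Ga], [Ga,G1,Gb], [Ga,Gb,G1], [Gb,G1,Ga], [Gb,Ga,G1]}"

text \<open>In characteristic 2 the permanent of a Vandermonde matrix is its determinant.\<close>

lemma sum_triples_power:
  assumes "\<forall>k<3. d k \<le> (2::nat)"
  shows "(\<Sum>h\<in>triples. \<Prod>k<3. h ! k ^ d k) = of_bool (distinct [d 0, d 1, d 2])"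
proof -
  have *: "m = 0 \<or> m = 1 \<or> m = 2" if "m \<le> 2" for m :: nat using that by auto
  have d: "d 0 \<le> 2" "d 1 \<le> 2" "d 2 \<le> 2" using assms by auto
  have "(\<Sum>h\<in>triples. h ! 0 ^ d0 * h ! 1 ^ d1 * h ! 2 ^ d2) = of_bool (distinct [d0, d1, d2])"
    if "d0 \<le> 2" "d1 \<le> 2" "d2 \<le> 2" for d0 d1 d2 :: nat
    using *[OF that(1)] *[OF that(2)] *[OF that(3)]
    by (elim disjE) (simp_all add: triples_def gf4_unfold)
  from this[OF d] show ?thesis by (simp add: eval_nat_numeral)
qed

text \<open>The three F2-linear forms tr (Ga ^ k * x) identify gf4 with the even-weight vectors of
  length 3 over F2.\<close>

definition coord :: "nat \<Rightarrow> gf4 \<Rightarrow> gf4" where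
  "coord k x = Ga ^ k * x + (Ga ^ k * x)\<^sup>2"

lemma coord_add: "coord k (x + y) = coord k x + coord k y"
proof -
  have "(u + v)\<^sup>2 = u\<^sup>2 + v\<^sup>2" for u v :: gf4 by (simp add: power2_sum)
  thus ?thesis by (simp add: coord_def distrib_left add_ac)
qed

lemma coord_bit: "coord k x \<in> {0, 1}"
proof -
  have "y + y\<^sup>2 \<in> {0, 1}" for y :: gf4
    by (cases y; simp add: gf4_unfold)
  thus ?thesis by (simp add: coord_def)
qed

lemma coord_0 [simp]: "coord k 0 = 0"
  by (simp add: coord_def)

lemma coord_sum: "coord 0 x + coord 1 x + coord 2 x = 0"
  by (cases x; simp add: coord_def gf4_unfold)

lemma coord_inj: "coord 0 x = coord 0 y \<Longrightarrow> coord 1 x = coord 1 y \<Longrightarrow> x = y"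
  by (cases x; cases y; simp add: coord_def gf4_unfold)

lemma coord_surj:
  assumes "s \<in> {0, 1}" "s' \<in> {0, 1}"
  shows "\<exists>x. coord 0 x = s \<and> coord 1 x = s'"
proof -
  have "coord 0 G0 = G0 \<and> coord 1 G0 = G0" "coord 0 G1 = G0 \<and> coord 1 G1 = G1"
    "coord 0 Ga = G1 \<and> coord 1 Ga = G1" "coord 0 Gb = G1 \<and> coord 1 Gb = G0"
    by (simp_all add: coord_def gf4_unfold)
  thus ?thesis using assms unfolding zero_gf4_def one_gf4_def by blast
qed

text \<open>A nonzero \<open>u\<close> has exactly two coordinates equal to 1, and exactly one of
  the two orders of that pair is counted. This is the constant that a triple contributes to its own
  equation.\<close>

lemma coord_self:
  fixes p :: "nat \<Rightarrow> nat"
  assumes "inj_on p {..<3}"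
  shows "(\<Sum>k<3. \<Sum>l<3. of_bool (p l < p k) * coord k u * coord l u) = of_bool (u \<noteq> 0)"
proof -
  have "p 0 \<noteq> p 1" "p 0 \<noteq> p 2" "p 1 \<noteq> p 2" 
    using inj_onD[OF assms, of 0 1] inj_onD[OF assms, of 0 2] inj_onD[OF assms, of 1 2] by auto
  hence flip: "p 1 < p 0 \<longleftrightarrow> \<not> p 0 < p 1" "p 2 < p 0 \<longleftrightarrow> \<not> p 0 < p 2" "p 2 < p 1 \<longleftrightarrow> \<not> p 1 < p 2"
    by linarith+
  have sum3: "(\<Sum>k<3. f k) = f 0 + f 1 + f 2" for f :: "nat \<Rightarrow> gf4"
    by (simp add: eval_nat_numeral)
  show ?thesis unfolding sum3 flip
    by (cases "p 0 < p 1"; cases "p 0 < p 2"; cases "p 1 < p 2"; cases u;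
        simp add: coord_def gf4_unfold)
qed

text \<open>\<open>a k\<close> is the bit of the edge before a vertex and
  \<open>a k + coord k u\<close> that of the edge after it. The indegree \<open>e k\<close> is 1 if
  the bits agree, and otherwise 2 or 0 according to \<open>a k\<close> being 0 or 1. So exactly two
  vertices must see a change, with different \<open>a k\<close>.\<close>

lemma distinct_degrees_iff:
  fixes a :: "nat \<Rightarrow> gf4" and u :: gf4
  assumes "\<And>k. a k \<in> {0, 1}"
  defines "e \<equiv> \<lambda>k. of_bool (a k \<noteq> 1) + of_bool (a k + coord k u = 1) :: nat"
  shows "distinct [e 0, e 1, e 2] \<longleftrightarrow> u \<noteq> 0 \<and> (\<Sum>k<3. coord k u * a k) = 1"
proof -
  have a: "a 0 = G0 \<or> a 0 = G1" "a 1 = G0 \<or> a 1 = G1" "a 2 = G0 \<or> a 2 = G1"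
    using assms(1) by (auto simp: zero_gf4_def one_gf4_def)
  have s: "(\<Sum>k<3. coord k u * a k) = coord 0 u * a 0 + coord 1 u * a 1 + coord 2 u * a 2"
    by (simp add: eval_nat_numeral)
  show ?thesis unfolding s unfolding e_def using a
    by (cases u; elim disjE; simp add: coord_def gf4_unfold)
qed

section \<open>Orientations with balanced triples as solutions of a quadratic system\<close>

lemma sum_positions:
  assumes "bij_betw (\<lambda>(t, k). pos t k) ({..<n} \<times> {..<3}) {..<3 * n}"
  shows "(\<Sum>p<3 * n. f p) = (\<Sum>t<n. \<Sum>k<3. f (pos t k))"
  using sum.reindex_bij_betw[OF assms, of f]
  by (simp add: sum.cartesian_product case_prod_beta)

lemma prod_positions:
  assumes "bij_betw (\<lambda>(t, k). pos t k) ({..<n} \<times> {..<3}) {..<3 * n}"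
  shows "(\<Prod>p<3 * n. f p) = (\<Prod>t<n. \<Prod>k<3. f (pos t k))"
  using prod.reindex_bij_betw[OF assms, of f]
  by (simp add: prod.cartesian_product case_prod_beta)

locale triple_arrangement =
  fixes pos :: "nat \<Rightarrow> nat \<Rightarrow> nat" and n :: nat
  assumes bij: "bij_betw (\<lambda>(t, k). pos t k) ({..<n} \<times> {..<3}) {..<3 * n}"
begin

abbreviation N :: nat where "N \<equiv> 3 * n"

lemma pos_less: "t < n \<Longrightarrow> k < 3 \<Longrightarrow> pos t k < N"
  using bij_betwE[OF bij] by auto

lemma pos_eq_iff: "t < n \<Longrightarrow> k < 3 \<Longrightarrow> t' < n \<Longrightarrow> k' < 3 \<Longrightarrow> pos t k = pos t' k' \<longleftrightarrow> t = t' \<and> k = k'"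
  using bij_betw_imp_inj_on[OF bij] by (auto dest: inj_onD[where x = "(t, k)" and y = "(t', k')"])

lemma pos_cases:
  assumes "p < N"
  obtains t k where "t < n" "k < 3" "p = pos t k"
proof -
  have "p \<in> (\<lambda>(t, k). pos t k) ` ({..<n} \<times> {..<3})"
    using bij_betw_imp_surj_on[OF bij] assms by simp
  thus ?thesis using that by auto
qed

definition slot :: "nat \<Rightarrow> nat \<times> nat" where
  "slot = inv_into ({..<n} \<times> {..<3}) (\<lambda>(t, k). pos t k)"

lemma slot_pos: "t < n \<Longrightarrow> k < 3 \<Longrightarrow> slot (pos t k) = (t, k)"
  unfolding slot_def using inv_into_f_f[OF bij_betw_imp_inj_on[OF bij], of "(t, k)"] by simp

text \<open>Counts modulo 2 the pairs of direction changes, one at a vertex of \<open>t\<close> and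
  one at an earlier vertex of \<open>t'\<close>. Equal triples are left out, since they yield the
  constant of \<open>coord_self\<close>.\<close>

definition B :: "nat \<Rightarrow> nat \<Rightarrow> gf4 \<Rightarrow> gf4 \<Rightarrow> gf4" where
  "B t t' u v = (if t \<noteq> t' \<and> t < n \<and> t' < n
     then \<Sum>k<3. \<Sum>l<3. of_bool (pos t' l < pos t k) * coord k u * coord l v else 0)"

lemma sum3: "(\<Sum>k<3. f k) = f 0 + f 1 + f (2::nat)" for f :: "nat \<Rightarrow> gf4"
  by (simp add: eval_nat_numeral)

text \<open>Of two positions exactly one is earlier, so the two sides add up to the product of the
  full coordinate sums, which are 0 by \<open>coord_sum\<close>.\<close>

lemma B_symmetric: "B t t' u v = B t' t v u"
proof (cases "t \<noteq> t' \<and> t < n \<and> t' < n")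
  case True
  have flip: "of_bool (pos t' l < pos t k) = 1 + (of_bool (pos t k < pos t' l) :: gf4)"
    if "k < 3" "l < 3" for k l
    using pos_eq_iff[of t k t' l] that True by auto
  have total: "(\<Sum>k<3. \<Sum>l<3. coord k u * coord l v) = 0"
  proof -
    have "(\<Sum>k<3. coord k u) = 0" using coord_sum[of u] by (simp only: sum3)
    thus ?thesis by (simp only: sum_product[symmetric] mult_zero_left)
  qed
  have "B t t' u v = (\<Sum>k<3. \<Sum>l<3. (1 + of_bool (pos t k < pos t' l)) * coord k u * coord l v)"
    using True flip by (simp add: B_def)
  also have "\<dots> = (\<Sum>k<3. \<Sum>l<3. coord k u * coord l v)
      + (\<Sum>k<3. \<Sum>l<3. of_bool (pos t k < pos t' l) * coord k u * coord l v)"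
    by (simp add: sum.distrib distrib_right)
  also have "(\<Sum>k<3. \<Sum>l<3. of_bool (pos t k < pos t' l) * coord k u * coord l v) = B t' t v u"
    using True by (subst sum.swap) (simp add: B_def mult_ac)
  finally show ?thesis using total by simp
qed (auto simp: B_def)

sublocale block_form "{..<n}" B
proof
  show "B s t (u + u') v = B s t u v + B s t u' v" for s t u u' v
    by (simp add: B_def coord_add sum.distrib algebra_simps)
  show "B s t u v \<in> {0, 1}" for s t u v
  proof -
    have "of_bool (pos t l < pos s k) * coord k u * coord l v \<in> {0, 1}" for k l
      using coord_bit[of k u] coord_bit[of l v] by auto
    thus ?thesis unfolding B_def by (auto intro!: sum_bit_gf4 simp del: insert_iff)
  qed
qed (auto simp: B_symmetric, simp add: B_def)

text \<open>An orientation of the path on N vertices with a pendant edge into vertex 0 is a function b: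
  b p holds if edge p, between p - 1 and p, points to p - 1; edge 0 always points to vertex 0.\<close>

definition orientations :: "(nat \<Rightarrow> bool) set" where
  "orientations = PiE {..<N} (\<lambda>i. if i = 0 then {False} else UNIV)"

definition indeg :: "(nat \<Rightarrow> bool) \<Rightarrow> nat \<Rightarrow> nat" where
  "indeg b p = of_bool (\<not> b p) + of_bool (Suc p < N \<and> b (Suc p))"

text \<open>Indegrees are at most 2, so distinct ones are 0, 1, 2, with sum 3 per triple. The
  pendant edge brings the number of edges up to the required total \<open>N\<close>.\<close>

definition balanced :: "(nat \<Rightarrow> bool) set" where
  "balanced = {b \<in> orientations.
     \<forall>t<n. distinct [indeg b (pos t 0), indeg b (pos t 1), indeg b (pos t 2)]}"

text \<open>Orientations and elements of supported {..<n} correspond: the bit of x at a vertex says whether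
  the orientation of the two incident edges changes there.\<close>

definition turn :: "(nat \<Rightarrow> gf4) \<Rightarrow> nat \<Rightarrow> gf4" where
  "turn x p = coord (snd (slot p)) (x (fst (slot p)))"

text \<open>The direction bit of edge \<open>i\<close>: edge 0 has bit 0, and each change at an
  earlier vertex adds 1.\<close>

definition pre :: "(nat \<Rightarrow> gf4) \<Rightarrow> nat \<Rightarrow> gf4" where
  "pre x i = (\<Sum>p<i. turn x p)"

definition orient :: "(nat \<Rightarrow> gf4) \<Rightarrow> nat \<Rightarrow> bool" where
  "orient x = restrict (\<lambda>i. pre x i = 1) {..<N}"

lemma turn_pos: "t < n \<Longrightarrow> k < 3 \<Longrightarrow> turn x (pos t k) = coord k (x t)"
  by (simp add: turn_def slot_pos)

lemma turn_bit: "turn x p \<in> {0, 1}"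
  unfolding turn_def by (rule coord_bit)

lemma pre_bit: "pre x i \<in> {0, 1}"
  unfolding pre_def by (rule sum_bit_gf4) (rule turn_bit)

lemma pre_Suc: "pre x (Suc i) = pre x i + turn x i"
  by (simp add: pre_def add.commute)

text \<open>The coordinates of every triple sum to 0. So the edge missing after the last vertex gets
  bit 0, which agrees with its omission in \<open>indeg\<close>.\<close>

lemma pre_N: "pre x N = 0"
  unfolding pre_def sum_positions[OF bij]
  using coord_sum by (intro sum.neutral) (auto simp: turn_pos sum3)

lemma orient_in: "orient x \<in> orientations"
  by (auto simp: orient_def orientations_def pre_def)

lemma indeg_orient:
  assumes "t < n" "k < 3"
  shows "indeg (orient x) (pos t k)
    = of_bool (pre x (pos t k) \<noteq> 1) + of_bool (pre x (pos t k) + coord k (x t) = 1)"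
proof -
  have p: "pos t k < N" using pos_less assms by blast
  have "pre x (Suc (pos t k)) = pre x (pos t k) + coord k (x t)"
    using pre_Suc turn_pos assms by simp
  moreover have "Suc (pos t k) < N \<or> pre x (Suc (pos t k)) = 0"
    using p pre_N by (metis Suc_lessI)
  ultimately show ?thesis using p unfolding indeg_def orient_def by auto
qed

text \<open>Expand the prefix sums and group the earlier vertices by triple: other triples give the
  forms \<open>B\<close>, and \<open>t\<close> itself gives the constant.\<close>

lemma sum_coord_pre:
  assumes "t < n"
  shows "(\<Sum>k<3. coord k (x t) * pre x (pos t k)) = R t x + of_bool (x t \<noteq> 0)"
proof -
  let ?h = "\<lambda>s. \<Sum>k<3. \<Sum>l<3. of_bool (pos s l < pos t k) * coord k (x t) * coord l (x s)"
  have pre: "pre x (pos t k) = (\<Sum>s<n. \<Sum>l<3. of_bool (pos s l < pos t k) * coord l (x s))"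
    if "k < 3" for k
  proof -
    have "pre x (pos t k) = (\<Sum>p<N. of_bool (p < pos t k) * turn x p)"
      unfolding pre_def using pos_less[OF assms that]
      by (intro sum.mono_neutral_cong_left) auto
    also have "\<dots> = (\<Sum>s<n. \<Sum>l<3. of_bool (pos s l < pos t k) * coord l (x s))"
      unfolding sum_positions[OF bij] by (intro sum.cong refl) (simp add: turn_pos)
    finally show ?thesis .
  qed
  have "(\<Sum>k<3. coord k (x t) * pre x (pos t k))
      = (\<Sum>k<3. \<Sum>s<n. \<Sum>l<3. of_bool (pos s l < pos t k) * coord k (x t) * coord l (x s))"
    by (intro sum.cong refl) (simp only: pre lessThan_iff sum_distrib_left mult_ac)
  also have "\<dots> = (\<Sum>s<n. ?h s)" by (rule sum.swap)
  also have "\<dots> = ?h t + (\<Sum>s\<in>{..<n} - {t}. ?h s)"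
    using assms by (intro sum.remove) auto
  also have "?h t = of_bool (x t \<noteq> 0)"
    using assms by (intro coord_self inj_onI) (simp add: pos_eq_iff)
  also have "(\<Sum>s\<in>{..<n} - {t}. ?h s) = (\<Sum>s\<in>{..<n} - {t}. B t s (x t) (x s))"
    using assms by (intro sum.cong) (auto simp: B_def)
  also have "\<dots> = R t x"
    unfolding R_def using assms by (subst sum.remove[of _ t]) (auto simp: B_def)
  finally show ?thesis by (simp add: add.commute)
qed

text \<open>The constant is 1 when \<open>x t\<close> is nonzero, so the inhomogeneous condition of
  \<open>distinct_degrees_iff\<close> turns into the homogeneous equation
  \<open>R t x = 0\<close>.\<close>

lemma balanced_orient_iff:
  "orient x \<in> balanced \<longleftrightarrow> (\<forall>t<n. x t \<noteq> 0 \<and> R t x = 0)"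
proof -
  have "distinct [indeg (orient x) (pos t 0), indeg (orient x) (pos t 1), indeg (orient x) (pos t 2)]
      \<longleftrightarrow> x t \<noteq> 0 \<and> R t x = 0" if "t < n" for t
  proof -
    have "distinct [indeg (orient x) (pos t 0), indeg (orient x) (pos t 1), indeg (orient x) (pos t 2)]
        \<longleftrightarrow> x t \<noteq> 0 \<and> (\<Sum>k<3. coord k (x t) * pre x (pos t k)) = 1"
      using distinct_degrees_iff[of "\<lambda>k. pre x (pos t k)" "x t"] pre_bit
      by (simp only: indeg_orient[OF that] less_numeral_extra zero_less_numeral numeral_less_iff
          one_less_numeral_iff semiring_norm)
    thus ?thesis using sum_coord_pre[OF that, of x] by (auto simp del: insert_iff)
  qed
  thus ?thesis using orient_in by (simp add: balanced_def)
qed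

lemma inj_on_orient: "inj_on orient (supported {..<n})"
proof (rule inj_onI)
  fix x y assume x: "x \<in> supported {..<n}" and y: "y \<in> supported {..<n}" and eq: "orient x = orient y"
  have pre: "pre x i = pre y i" if "i \<le> N" for i
  proof (cases "i = N")
    case False
    hence "pre x i = 1 \<longleftrightarrow> pre y i = 1"
      using that fun_cong[OF eq, of i] by (simp add: orient_def)
    thus ?thesis using pre_bit[of x i] pre_bit[of y i] by auto
  qed (simp add: pre_N)
  have "turn x i = turn y i" if "i < N" for i
    using pre[of i] pre[of "Suc i"] that by (simp add: pre_Suc)
  hence "coord k (x t) = coord k (y t)" if "t < n" "k < 3" for t k
    using that turn_pos pos_less by metis
  hence "x t = y t" if "t < n" for t
    using that coord_inj[of "x t" "y t"] by simp
  thus "x = y" using x y by (auto simp: supported_def fun_eq_iff) (metis lessThan_iff)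
qed

text \<open>Surjectivity prescribes only two of the three coordinates of \<open>x t\<close>. The
  third is right because just the vertices of indegree 0 and 2 change direction, so each triple has
  an even number of changes.\<close>

lemma balanced_is_orient:
  assumes "b \<in> balanced"
  shows "\<exists>x\<in>supported {..<n}. b = orient x"
proof -
  define b' where "b' i \<longleftrightarrow> i < N \<and> b i" for i
  define s where "s p = (of_bool (b' p \<noteq> b' (Suc p)) :: gf4)" for p
  have b: "b \<in> orientations" using assms by (simp add: balanced_def)
  have "\<exists>x. coord 0 x = s (pos t 0) \<and> coord 1 x = s (pos t 1)" for t
    by (rule coord_surj) (auto simp: s_def)
  then obtain z where z: "coord 0 (z t) = s (pos t 0)" "coord 1 (z t) = s (pos t 1)" for t
    by metis
  define x where "x t = (if t < n then z t else 0)" for t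
  have third: "coord 2 (x t) = s (pos t 2)" if "t < n" for t
  proof -
    have ind: "indeg b p = of_bool (\<not> b' p) + of_bool (b' (Suc p))" if "p < N" for p
      using that by (auto simp: indeg_def b'_def)
    have d: "distinct [indeg b (pos t 0), indeg b (pos t 1), indeg b (pos t 2)]"
      using assms that by (simp add: balanced_def)
    have "s (pos t 0) + s (pos t 1) + s (pos t 2) = 0"
      using d that unfolding s_def
      by (cases "b' (pos t 2)") (auto simp: ind pos_less split: if_splits)
    moreover have "coord 0 (x t) + coord 1 (x t) + coord 2 (x t) = 0" by (rule coord_sum)
    ultimately show ?thesis using z[of t] that by (simp add: x_def) (metis gf4_add_eq_0_iff)
  qed
  have turn: "turn x p = s p" if "p < N" for p
  proof -
    obtain t k where tk: "t < n" "k < 3" "p = pos t k" using \<open>p < N\<close> by (rule pos_cases)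
    hence "k = 0 \<or> k = 1 \<or> k = 2" by auto
    thus ?thesis using tk z[of t] third[of t] by (auto simp: turn_pos x_def)
  qed
  have pre: "pre x i = of_bool (b' i)" if "i \<le> N" for i
    using that
  proof (induction i)
    case 0
    have "\<not> b' 0" using PiE_mem[OF b[unfolded orientations_def], of 0] by (auto simp: b'_def)
    thus ?case by (simp add: pre_def)
  next
    case (Suc i)
    thus ?case using turn[of i] by (auto simp: pre_Suc s_def)
  qed
  have "orient x = b"
  proof
    fix i
    show "orient x i = b i"
    proof (cases "i < N")
      case True
      thus ?thesis using pre[of i] by (simp add: orient_def b'_def)
    next
      case False
      thus ?thesis using PiE_arb[OF b[unfolded orientations_def], of i] by (simp add: orient_def)
    qed
  qed
  moreover have "x \<in> supported {..<n}" by (simp add: x_def supported_def)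
  ultimately show ?thesis by blast
qed

lemma odd_card_balanced: "odd (card balanced)"
proof -
  let ?X = "{x. (\<forall>t. x t \<noteq> 0 \<longleftrightarrow> t \<in> {..<n}) \<and> (\<forall>t\<in>{..<n}. R t x = 0)}"
  have sub: "?X \<subseteq> supported {..<n}" by (auto simp: supported_def)
  have "balanced = orient ` ?X"
  proof (intro equalityI subsetI)
    fix b assume b: "b \<in> balanced"
    then obtain x where x: "x \<in> supported {..<n}" "b = orient x" using balanced_is_orient by blast
    with b have "x \<in> ?X" by (auto simp: balanced_orient_iff supported_def)
    thus "b \<in> orient ` ?X" using x by blast
  qed (auto simp: balanced_orient_iff)
  thus ?thesis
    using odd_card_full_support[of "{..<n}"] card_image[OF inj_on_subset[OF inj_on_orient sub]] by simp
qed

text \<open>Without such a colouring each summand has a factor 0, as equal colours add up to 0; the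
  expansion shows that the sum is 1.\<close>

theorem ex_colouring:
  "\<exists>c :: nat \<Rightarrow> gf4. (\<forall>p<N. c p \<noteq> 0) \<and> (\<forall>p. Suc p < N \<longrightarrow> c p \<noteq> c (Suc p))
     \<and> (\<forall>t<n. inj_on (\<lambda>k. c (pos t k)) {..<3})"
proof (rule ccontr)
  assume none: "\<not> ?thesis"
  define col where "col g p = (g (fst (slot p)) ! snd (slot p) :: gf4)" for g :: "nat \<Rightarrow> gf4 list" and p
  define G where "G = PiE {..<n} (\<lambda>_. triples)"
  have col_pos: "col g (pos t k) = g t ! k" if "t < n" "k < 3" for g t k
    using that by (simp add: col_def slot_pos)
  have term_0: "(\<Prod>i<N. if i = 0 then col g 0 else col g (i - 1) + col g i) = 0" if g: "g \<in> G" for g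
  proof -
    have tri: "h ! k \<noteq> 0 \<and> inj_on (\<lambda>k. h ! k) {..<3}" if "h \<in> triples" "k < 3" for h k
    proof -
      have *: "{..<3} = {0, 1, 2::nat}" by auto
      have "k = 0 \<or> k = 1 \<or> k = 2" using that by auto
      thus ?thesis using that(1) unfolding * by (auto simp: triples_def zero_gf4_def)
    qed
    have mem: "g t \<in> triples" if "t < n" for t using g that by (auto simp: G_def)
    have "col g p \<noteq> 0" if "p < N" for p
    proof -
      obtain t k where "t < n" "k < 3" "p = pos t k" using \<open>p < N\<close> by (rule pos_cases)
      thus ?thesis using tri mem col_pos by metis
    qed
    moreover have "inj_on (\<lambda>k. col g (pos t k)) {..<3}" if "t < n" for t
    proof -
      have "inj_on (\<lambda>k. g t ! k) {..<3}" using tri[of "g t" 0] mem that by simp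
      thus ?thesis using col_pos[OF that] by (simp add: inj_on_def)
    qed
    ultimately obtain p where "Suc p < N" "col g p = col g (Suc p)" using none by blast
    thus ?thesis by (intro prod_zero) (auto intro!: bexI[of _ "Suc p"])
  qed
  have expand: "(\<Sum>g\<in>G. \<Prod>p<N. col g p ^ indeg b p) = of_bool (b \<in> balanced)"
    if b: "b \<in> orientations" for b
  proof -
    have "(\<Sum>g\<in>G. \<Prod>p<N. col g p ^ indeg b p)
        = (\<Sum>g\<in>G. \<Prod>t<n. \<Prod>k<3. g t ! k ^ indeg b (pos t k))"
      unfolding prod_positions[OF bij] by (intro sum.cong prod.cong refl) (simp add: col_pos)
    also have "\<dots> = (\<Prod>t<n. \<Sum>h\<in>triples. \<Prod>k<3. h ! k ^ indeg b (pos t k))"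
      unfolding G_def by (rule prod_sum_PiE[symmetric]) (auto simp: triples_def)
    also have "\<dots> = (\<Prod>t<n. of_bool
        (distinct [indeg b (pos t 0), indeg b (pos t 1), indeg b (pos t 2)]))"
      by (intro prod.cong refl sum_triples_power) (auto simp: indeg_def)
    also have "\<dots> = of_bool (b \<in> balanced)"
    proof (cases "b \<in> balanced")
      case False
      then obtain t where t: "t < n"
        "\<not> distinct [indeg b (pos t 0), indeg b (pos t 1), indeg b (pos t 2)]"
        using b unfolding balanced_def by blast
      hence "(\<Prod>t<n. of_bool (distinct [indeg b (pos t 0), indeg b (pos t 1), indeg b (pos t 2)])) = (0::gf4)"
        by (intro prod_zero) (auto intro!: bexI[of _ t])
      thus ?thesis using False by simp
    qed (simp add: balanced_def)
    finally show ?thesis .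
  qed
  have fin: "finite orientations" by (auto simp: orientations_def intro: finite_PiE)
  have "0 = (\<Sum>g\<in>G. \<Prod>i<N. if i = 0 then col g 0 else col g (i - 1) + col g i)"
    using term_0 by simp
  also have "\<dots> = (\<Sum>g\<in>G. \<Sum>b\<in>orientations. \<Prod>p<N. col g p ^ indeg b p)"
    unfolding prod_path_orientations orientations_def indeg_def ..
  also have "\<dots> = (\<Sum>b\<in>orientations. \<Sum>g\<in>G. \<Prod>p<N. col g p ^ indeg b p)"
    by (rule sum.swap)
  also have "\<dots> = (\<Sum>b\<in>orientations. of_bool (b \<in> balanced))"
    using expand by simp
  also have "\<dots> = of_nat (card balanced)"
    using fin by (simp add: balanced_def Int_def)
  finally show False using odd_card_balanced by (simp add: of_nat_gf4)
qed

end

theorem path_plus_triangles: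
  fixes vs :: "'a list" and T :: "nat \<Rightarrow> 'a set"
  assumes "distinct vs" and card: "\<forall>j<n. card (T j) = 3"
    and disj: "\<forall>i<n. \<forall>j<n. i \<noteq> j \<longrightarrow> T i \<inter> T j = {}"
    and vs: "set vs = (\<Union>j<n. T j)"
  shows "\<exists>c :: 'a \<Rightarrow> nat. (\<forall>v\<in>set vs. c v < 3)
    \<and> (\<forall>i. Suc i < length vs \<longrightarrow> c (vs ! i) \<noteq> c (vs ! Suc i)) \<and> (\<forall>j<n. inj_on c (T j))"
proof -
  have "\<exists>f. bij_betw f {..<3::nat} (T j)" if "j < n" for j
    using ex_bij_betw_nat_finite[of "T j"] card that
    by (metis atLeast0LessThan card.infinite zero_neq_numeral)
  then obtain f where f: "bij_betw (f j) {..<3::nat} (T j)" if "j < n" for j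
    by metis
  have f_bij: "bij_betw (\<lambda>(j, k). f j k) ({..<n} \<times> {..<3}) (set vs)"
  proof (rule bij_betw_imageI)
    show "inj_on (\<lambda>(j, k). f j k) ({..<n} \<times> {..<3})"
    proof (rule inj_onI, clarsimp)
      fix i k j l assume ij: "i < n" "j < n" and kl: "k < (3::nat)" "l < (3::nat)" and eq: "f i k = f j l"
      have "f i k \<in> T i" "f j l \<in> T j" using f ij kl by (auto dest: bij_betwE)
      hence "i = j" using disj ij eq by (metis disjoint_iff)
      moreover have "k = l" using bij_betw_imp_inj_on[OF f[OF ij(1)]] kl eq \<open>i = j\<close> by (simp add: inj_on_def)
      ultimately show "i = j \<and> k = l" by simp
    qed
    have "T j = f j ` {..<3}" if "j < n" for j
      using bij_betw_imp_surj_on[OF f[OF that]] by simp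
    thus "(\<lambda>(j, k). f j k) ` ({..<n} \<times> {..<3}) = set vs" unfolding vs by auto
  qed
  have len: "length vs = 3 * n"
    using bij_betw_same_card[OF f_bij] distinct_card[OF assms(1)] by (simp add: card_cartesian_product)
  define ix where "ix = inv_into {..<length vs} ((!) vs)"
  have nth: "bij_betw ((!) vs) {..<length vs} (set vs)"
    using assms(1) by (rule bij_betw_nth) auto
  have ix: "ix (vs ! i) = i" if "i < length vs" for i
    using bij_betw_imp_inj_on[OF nth] that by (simp add: ix_def)
  have "bij_betw ix (set vs) {..<3 * n}"
    unfolding ix_def len[symmetric] by (rule bij_betw_inv_into[OF nth])
  from bij_betw_trans[OF f_bij this]
  interpret triple_arrangement "\<lambda>j k. ix (f j k)" n
    by unfold_locales (simp add: comp_def case_prod_unfold)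
  obtain c where c: "\<forall>p<3 * n. c p \<noteq> (0::gf4)" "\<forall>p. Suc p < 3 * n \<longrightarrow> c p \<noteq> c (Suc p)"
    "\<forall>t<n. inj_on (\<lambda>k. c (ix (f t k))) {..<3}"
    using ex_colouring by blast
  \<comment> \<open>The value 3 at \<open>G0\<close> is a dummy that only keeps \<open>code\<close>
    injective; the colours used are nonzero.\<close>
  define code :: "gf4 \<Rightarrow> nat" where "code x = (case x of G0 \<Rightarrow> 3 | G1 \<Rightarrow> 0 | Ga \<Rightarrow> 1 | Gb \<Rightarrow> 2)" for x
  have code: "code x = code y \<longleftrightarrow> x = y" "x \<noteq> 0 \<Longrightarrow> code x < 3" for x y
    by (auto simp: code_def zero_gf4_def split: gf4.splits)
  show ?thesis
  proof (intro exI[of _ "\<lambda>v. code (c (ix v))"] conjI ballI allI impI)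
    fix v assume "v \<in> set vs"
    then obtain i where "i < length vs" "v = vs ! i" by (metis in_set_conv_nth)
    thus "code (c (ix v)) < 3" using c(1) ix len by (simp add: code)
  next
    fix i assume "Suc i < length vs"
    thus "code (c (ix (vs ! i))) \<noteq> code (c (ix (vs ! Suc i)))" using c(2) ix len by (simp add: code)
  next
    fix j assume j: "j < n"
    have "T j = f j ` {..<3}" using bij_betw_imp_surj_on[OF f[OF j]] by simp
    thus "inj_on (\<lambda>v. code (c (ix v))) (T j)"
      using c(3) j by (auto simp: inj_on_def code)
  qed
qed

section \<open>Transversals that meet every cycle\<close>

text \<open>Fix an independent transversal \<open>s\<close> meeting the most sets of
  \<open>\<C>\<close> and suppose that one is missed. Exchanges then produce more and more sets,
  each of which can be the missed one after changes at few indices, until more than \<open>q\<close>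
  indices are needed.\<close>

lemma hitting_transversal:
  fixes Y :: "nat \<Rightarrow> 'a set" and E :: "'a \<Rightarrow> 'a \<Rightarrow> bool" and \<C> :: "'a set set"
  assumes card_Y: "\<forall>j<q. card (Y j) = 4"
    and fin: "finite \<C>" and disj: "\<forall>C\<in>\<C>. \<forall>D\<in>\<C>. C \<noteq> D \<longrightarrow> C \<inter> D = {}"
    and cover: "\<forall>C\<in>\<C>. C \<subseteq> (\<Union>j<q. Y j)"
    and closed: "\<forall>C\<in>\<C>. \<forall>x\<in>C. \<forall>y. E x y \<longrightarrow> y \<in> C"
    and sym: "\<forall>x y. E x y \<longrightarrow> E y x" and irrefl: "\<forall>x. \<not> E x x"
    and large: "\<forall>\<D>\<subseteq>\<C>. 4 * card \<D> \<le> card (\<Union>\<D>) + 3"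
    and s0: "\<forall>j<q. s0 j \<in> Y j" "\<forall>i<q. \<forall>j<q. \<not> E (s0 i) (s0 j)"
  shows "\<exists>s. (\<forall>j<q. s j \<in> Y j) \<and> (\<forall>i<q. \<forall>j<q. \<not> E (s i) (s j)) \<and> (\<forall>C\<in>\<C>. \<exists>j<q. s j \<in> C)"
proof -
  define transv where
    "transv s \<longleftrightarrow> (\<forall>j<q. s j \<in> Y j) \<and> (\<forall>i<q. \<forall>j<q. \<not> E (s i) (s j))" for s
  define hits where "hits s = {C \<in> \<C>. \<exists>j<q. s j \<in> C}" for s :: "nat \<Rightarrow> 'a"
  have fin_hits: "finite (hits s)" for s using fin by (simp add: hits_def)
  have "\<forall>s. transv s \<longrightarrow> card (hits s) < Suc (card \<C>)"
    using card_mono[OF fin] by (auto simp: hits_def less_Suc_eq_le)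
  moreover have "transv s0" using s0 by (simp add: transv_def)
  ultimately obtain s where s: "transv s" "\<And>s'. transv s' \<Longrightarrow> card (hits s') \<le> card (hits s)"
    using ex_has_greatest_nat[of transv s0 "\<lambda>s. card (hits s)" "Suc (card \<C>)"] by blast
  have "hits s = \<C>"
  proof (rule ccontr)
    assume "hits s \<noteq> \<C>"
    then obtain C0 where C0: "C0 \<in> \<C>" "C0 \<notin> hits s" by (auto simp: hits_def)
    \<comment> \<open>\<open>D\<close> can be the missed set at the cost of changes in
      \<open>J\<close> only. Freezing the other indices is what forces each newly lost set to lie
      outside \<open>\<D>\<close>.\<close>
    define ok where "ok J D s' \<longleftrightarrow> transv s' \<and> D \<notin> hits s' \<and> card (hits s) \<le> card (hits s')
      \<and> (\<forall>j<q. j \<notin> J \<longrightarrow> s' j = s j)" for J D s'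
    have "\<exists>J \<D>. J \<subseteq> {..<q} \<and> card J = k \<and> \<D> \<subseteq> \<C> \<and> card \<D> = Suc k \<and> (\<forall>D\<in>\<D>. \<exists>s'. ok J D s')" for k
    proof (induction k)
      case 0
      show ?case
        using C0 s(1) by (intro exI[of _ "{}"] exI[of _ "{C0}"]) (auto simp: ok_def)
    next
      case (Suc k)
      then obtain J \<D> where J: "J \<subseteq> {..<q}" "card J = k" and D: "\<D> \<subseteq> \<C>" "card \<D> = Suc k"
        and ok: "\<And>D. D \<in> \<D> \<Longrightarrow> \<exists>s'. ok J D s'" by blast
      have finJ: "finite J" using J(1) finite_subset by blast
      have fin\<D>: "finite \<D>" using D(1) fin finite_subset by blast
      have finY: "finite (Y j)" if "j < q" for j
        using card_Y that by (metis card.infinite zero_neq_numeral)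
      \<comment> \<open>The sets \<open>Y j\<close> with \<open>j\<close> in \<open>J\<close> hold
        at most \<open>4 * k\<close> vertices, but the \<open>k + 1\<close> sets in
        \<open>\<D>\<close> have at least \<open>4 * k + 1\<close>, so one of them has a vertex
        elsewhere.\<close>
      have "card (\<Union>j\<in>J. Y j) \<le> (\<Sum>j\<in>J. card (Y j))" by (rule card_UN_le[OF finJ])
      also have "\<dots> = 4 * k" using card_Y J by (subst sum.cong[of J J _ "\<lambda>_. 4"]) auto
      also have "\<dots> < card (\<Union>\<D>)" using large D by auto
      finally have "\<not> \<Union>\<D> \<subseteq> (\<Union>j\<in>J. Y j)"
        using finJ finY J(1) by (metis card_mono finite_UN_I leD lessThan_iff subsetD)
      then obtain y D where y: "y \<in> D" "D \<in> \<D>" "y \<notin> (\<Union>j\<in>J. Y j)" by blast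
      moreover have "y \<in> (\<Union>j<q. Y j)" using cover y D(1) by blast
      ultimately obtain j where j: "j < q" "y \<in> Y j" "j \<notin> J" by blast
      obtain sD where sD: "ok J D sD" using ok y(2) by blast
      define s' where "s' = sD(j := y)"
      have DC: "D \<in> \<C>" using y D by blast
      have not_D: "sD i \<notin> D" if "i < q" for i
        using sD DC that by (auto simp: ok_def hits_def)
      have s': "transv s'"
      proof -
        have "\<not> E y (sD i)" "\<not> E (sD i) y" if "i < q" for i
          using not_D[OF that] closed DC y(1) sym by blast+
        thus ?thesis using sD j irrefl by (auto simp: s'_def ok_def transv_def)
      qed
      have D_hit: "D \<in> hits s'" using DC j y(1) by (auto simp: hits_def s'_def)
      \<comment> \<open>A set lost in the exchange was met only at \<open>j\<close>, where
        \<open>sD\<close> still equals \<open>s\<close> because \<open>j\<close> is not in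
        \<open>J\<close>.\<close>
      have lost: "s j \<in> D'" if D': "D' \<in> hits sD" "D' \<notin> hits s'" for D'
      proof -
        obtain i where "i < q" "sD i \<in> D'" using D'(1) by (auto simp: hits_def)
        moreover from this have "i = j" using D' by (auto simp: hits_def s'_def split: if_splits)
        ultimately show ?thesis using sD j by (auto simp: ok_def)
      qed
      have "\<not> hits sD \<subseteq> hits s'"
      proof
        assume "hits sD \<subseteq> hits s'"
        hence "hits sD \<subset> hits s'" using D_hit sD by (auto simp: ok_def)
        hence "card (hits sD) < card (hits s')" by (intro psubset_card_mono fin_hits)
        thus False using s(2)[OF s'] sD by (auto simp: ok_def)
      qed
      then obtain D' where D': "D' \<in> hits sD" "D' \<notin> hits s'" by blast
      \<comment> \<open>A witness missing \<open>D'\<close> with changes only in \<open>J\<close>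
        would still contain \<open>s j\<close>, which lies in \<open>D'\<close>.\<close>
      have "D' \<notin> \<D>"
      proof
        assume "D' \<in> \<D>"
        then obtain s'' where "ok J D' s''" using ok by blast
        thus False using lost[OF D'] j D'(1) by (auto simp: ok_def hits_def)
      qed
      \<comment> \<open>Different members of \<open>\<C>\<close> are disjoint and every lost one
        contains \<open>s j\<close>, so only \<open>D'\<close> is lost and the count is
        kept.\<close>
      have "insert D (hits sD - {D'}) \<subseteq> hits s'"
      proof -
        have "D'' = D'" if "D'' \<in> hits sD" "D'' \<notin> hits s'" for D''
          using lost[OF that] lost[OF D'] disj that D' by (auto simp: hits_def)
        thus ?thesis using D_hit by blast
      qed
      hence "card (insert D (hits sD - {D'})) \<le> card (hits s')" by (intro card_mono fin_hits)
      moreover have "card (insert D (hits sD - {D'})) = card (hits sD)"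
        using sD card_Suc_Diff1[OF fin_hits D'(1)] fin_hits by (simp add: ok_def del: card_Diff_insert)
      ultimately have "ok (insert j J) D' s'"
        using sD s' D' by (auto simp: ok_def s'_def)
      moreover have "ok (insert j J) D s'" if "ok J D s'" for D s' using that by (auto simp: ok_def)
      ultimately have "\<forall>D\<in>insert D' \<D>. \<exists>s'. ok (insert j J) D s'" using ok by blast
      moreover have "insert D' \<D> \<subseteq> \<C>" using D(1) D' by (auto simp: hits_def)
      moreover have "card (insert D' \<D>) = Suc (Suc k)" using D \<open>D' \<notin> \<D>\<close> fin\<D> by simp
      moreover have "card (insert j J) = Suc k" using J j finJ by simp
      ultimately show ?case using J(1) j(1)
        by (intro exI[of _ "insert j J"] exI[of _ "insert D' \<D>"]) auto
    qed
    from this[of "Suc q"] obtain J where "J \<subseteq> {..<q}" "card J = Suc q" by blast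
    thus False using card_mono[of "{..<q}" J] by simp
  qed
  thus ?thesis using s(1) unfolding transv_def hits_def by blast
qed

section \<open>Graphs of maximum degree two\<close>

text \<open>The vertices of a path or cycle component in order. Apart from consecutive entries only
  the first and last can be adjacent, which for three or more entries is the case of a
  cycle.\<close>

definition strand :: "('a \<Rightarrow> 'a \<Rightarrow> bool) \<Rightarrow> 'a list \<Rightarrow> bool" where
  "strand E xs \<longleftrightarrow> distinct xs \<and> xs \<noteq> [] \<and> (\<forall>i. Suc i < length xs \<longrightarrow> E (xs ! i) (xs ! Suc i)) \<and>
     (\<forall>i<length xs. \<forall>v. E (xs ! i) v \<longrightarrow> (\<exists>j<length xs. v = xs ! j \<and>
        (j = Suc i \<or> i = Suc j \<or> i = 0 \<and> Suc j = length xs \<or> j = 0 \<and> Suc i = length xs)))"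

locale degree_two_graph =
  fixes V :: "'a set" and E :: "'a \<Rightarrow> 'a \<Rightarrow> bool"
  assumes simple: "simple_graph V E" and degree: "max_degree_le V E 2"
begin

lemma finite_V: "finite V"
  and E_V: "E u v \<Longrightarrow> u \<in> V \<and> v \<in> V"
  and E_sym: "E u v \<Longrightarrow> E v u"
  and E_irrefl: "\<not> E v v"
  using simple by (auto simp: simple_graph_def)

lemma third_neighbour:
  assumes "E v a" "E v b" "a \<noteq> b" "E v w"
  shows "w = a \<or> w = b"
proof (rule ccontr)
  assume "\<not> ?thesis"
  hence "card {a, b, w} = 3" using assms(3) by auto
  moreover have "finite {w. E v w}" using finite_V E_V by (rule_tac finite_subset[of _ V]) auto
  hence "card {a, b, w} \<le> card {w. E v w}" using assms by (intro card_mono) auto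
  moreover have "card {w. E v w} \<le> 2" using degree E_V assms(1) by (auto simp: max_degree_le_def degree_def)
  ultimately show False by simp
qed

text \<open>Take a longest path in \<open>W\<close>. Its ends have no neighbours off the path, and
  inner vertices have used up their degree, so an end is adjacent only to the next entry or to the
  other end.\<close>

lemma ex_strand:
  assumes "W \<subseteq> V" "W \<noteq> {}" and closed: "\<And>u v. u \<in> W \<Longrightarrow> E u v \<Longrightarrow> v \<in> W"
  shows "\<exists>xs. strand E xs \<and> set xs \<subseteq> W"
proof -
  define path where "path xs \<longleftrightarrow> distinct xs \<and> xs \<noteq> [] \<and> set xs \<subseteq> W \<and>
    (\<forall>i. Suc i < length xs \<longrightarrow> E (xs ! i) (xs ! Suc i))" for xs
  have finW: "finite W" using assms(1) finite_V finite_subset by blast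
  obtain w where "w \<in> W" using assms(2) by blast
  hence "path [w]" by (simp add: path_def)
  moreover have "\<forall>xs. path xs \<longrightarrow> length xs < Suc (card W)"
  proof (intro allI impI)
    fix ys assume "path ys"
    thus "length ys < Suc (card W)"
      using card_mono[OF finW, of "set ys"] distinct_card[of ys] by (simp add: path_def)
  qed
  ultimately obtain xs where xs: "path xs" and max: "\<And>ys. path ys \<Longrightarrow> length ys \<le> length xs"
    using ex_has_greatest_nat[of path "[w]" length] by blast
  let ?n = "length xs"
  have edge: "E (xs ! i) (xs ! Suc i)" if "Suc i < ?n" for i using xs that by (simp add: path_def)
  have dist: "xs ! i = xs ! j \<longleftrightarrow> i = j" if "i < ?n" "j < ?n" for i j
    using xs that by (simp add: path_def nth_eq_iff_index_eq)
  have inner: "v = xs ! (i - 1) \<or> v = xs ! Suc i" if "0 < i" "Suc i < ?n" "E (xs ! i) v" for i v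
    using third_neighbour[of "xs ! i" "xs ! (i - 1)" "xs ! Suc i" v] edge[of "i - 1"] edge[of i]
      dist[of "i - 1" "Suc i"] that E_sym by auto
  have ends: "xs ! 0 \<in> W" "xs ! (?n - 1) \<in> W"
    using xs nth_mem[of 0 xs] nth_mem[of "?n - 1" xs] by (auto simp: path_def)
  have first: "v \<in> set xs" if "E (xs ! 0) v" for v
  proof (rule ccontr)
    assume v: "v \<notin> set xs"
    have "v \<in> W" using closed[OF _ that] ends by blast
    hence "path (v # xs)" using xs v E_sym[OF that] by (auto simp: path_def nth_Cons split: nat.splits)
    thus False using max by fastforce
  qed
  have last: "v \<in> set xs" if "E (xs ! (?n - 1)) v" for v
  proof (rule ccontr)
    assume v: "v \<notin> set xs"
    have "v \<in> W" using closed[OF _ that] ends by blast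
    moreover have "E ((xs @ [v]) ! i) ((xs @ [v]) ! Suc i)" if "Suc i < Suc ?n" for i
    proof (cases "Suc i = ?n")
      case True
      hence "i = ?n - 1" by simp
      thus ?thesis using \<open>E (xs ! (?n - 1)) v\<close> True by (simp add: nth_append)
    next
      case False
      thus ?thesis using that edge by (simp add: nth_append)
    qed
    ultimately have "path (xs @ [v])" using xs v by (auto simp: path_def)
    thus False using max by fastforce
  qed
  have "\<exists>j<?n. v = xs ! j \<and>
      (j = Suc i \<or> i = Suc j \<or> i = 0 \<and> Suc j = ?n \<or> j = 0 \<and> Suc i = ?n)"
    if i: "i < ?n" and v: "E (xs ! i) v" for i v
  proof -
    consider "i = 0" | "Suc i = ?n" | "0 < i" "Suc i < ?n" using i by linarith
    thus ?thesis
    proof cases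
      case 1
      then obtain j where j: "j < ?n" "v = xs ! j" using first v by (metis in_set_conv_nth)
      have "j \<noteq> 0" using j v 1 E_irrefl by metis
      moreover have "0 = j - 1 \<or> 0 = Suc j" if "Suc j \<noteq> ?n"
        using inner[of j "xs ! 0"] E_sym[OF v] j 1 that \<open>j \<noteq> 0\<close> dist[of 0 "j - 1"] dist[of 0 "Suc j"] i
        by auto
      ultimately show ?thesis using j 1 by auto
    next
      case 2
      hence "i = ?n - 1" by simp
      then obtain j where j: "j < ?n" "v = xs ! j" using last v by (metis in_set_conv_nth)
      have "j \<noteq> i" using j v E_irrefl by metis
      moreover have "i = j - 1 \<or> i = Suc j" if "j \<noteq> 0"
        using inner[of j "xs ! i"] E_sym[OF v] j 2 that \<open>j \<noteq> i\<close> dist[of i "j - 1"] dist[of i "Suc j"] i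
        by auto
      ultimately show ?thesis using j 2 by (intro exI[of _ j]) auto
    next
      case 3
      hence "v = xs ! (i - 1) \<or> v = xs ! Suc i" using inner v by blast
      thus ?thesis
      proof
        assume "v = xs ! (i - 1)"
        thus ?thesis using 3 by (intro exI[of _ "i - 1"]) auto
      next
        assume "v = xs ! Suc i"
        thus ?thesis using 3 by (intro exI[of _ "Suc i"]) auto
      qed
    qed
  qed
  hence "strand E xs" using xs by (simp add: strand_def path_def)
  thus ?thesis using xs by (auto simp: path_def)
qed

lemma strand_closed:
  assumes "strand E xs" "u \<in> set xs" "E u v"
  shows "v \<in> set xs"
proof -
  obtain i where "i < length xs" "u = xs ! i" using assms(2) by (auto simp: in_set_conv_nth)
  hence "\<exists>j<length xs. v = xs ! j" using assms(1,3) unfolding strand_def by blast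
  thus ?thesis by auto
qed

theorem strand_decomposition:
  "\<exists>Ls. (\<forall>xs\<in>set Ls. strand E xs) \<and> distinct (concat Ls) \<and> set (concat Ls) = V"
proof -
  have "\<exists>Ls. (\<forall>xs\<in>set Ls. strand E xs) \<and> distinct (concat Ls) \<and> set (concat Ls) = W"
    if "finite W" "W \<subseteq> V" "\<And>u v. u \<in> W \<Longrightarrow> E u v \<Longrightarrow> v \<in> W" for W
    using that
  proof (induction W rule: finite_psubset_induct)
    case (psubset W)
    show ?case
    proof (cases "W = {}")
      case True
      thus ?thesis by (intro exI[of _ "[]"]) auto
    next
      case False
      then obtain xs where xs: "strand E xs" "set xs \<subseteq> W" using ex_strand psubset.prems by metis
      obtain x where "x \<in> set xs" using xs by (cases xs) (auto simp: strand_def)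
      hence "W - set xs \<subset> W" using xs(2) by blast
      moreover have "v \<in> W - set xs" if "u \<in> W - set xs" "E u v" for u v
        using that psubset.prems(2)[of u v] strand_closed[OF xs(1), of v u] E_sym by blast
      ultimately obtain Ls where "\<forall>xs\<in>set Ls. strand E xs" "distinct (concat Ls)"
        "set (concat Ls) = W - set xs"
        using psubset.IH[of "W - set xs"] psubset.prems(1) by blast
      thus ?thesis using xs by (intro exI[of _ "xs # Ls"]) (auto simp: strand_def distinct_concat_iff)
    qed
  qed
  thus ?thesis using finite_V E_V by blast
qed

lemma cycle_component:
  assumes "distinct xs" "length xs \<ge> 3"
    and edge: "\<And>i. i < length xs \<Longrightarrow> E (xs ! i) (xs ! (Suc i mod length xs))"
  shows "is_cycle_component V E (set xs)"
proof -
  let ?n = "length xs"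
  have n: "?n > 0" using assms(2) by linarith
  have dist: "xs ! i = xs ! j \<longleftrightarrow> i = j" if "i < ?n" "j < ?n" for i j
    using assms(1) that by (simp add: nth_eq_iff_index_eq)
  \<comment> \<open>The cyclic predecessor; adding \<open>?n\<close> avoids truncated subtraction at
    0. It differs from the successor as the length is at least 3, so these two are all
    neighbours.\<close>
  define prv where "prv i = (i + ?n - 1) mod ?n" for i
  have prv: "Suc (prv i) mod ?n = i" "prv i < ?n" "prv i \<noteq> Suc i mod ?n" if "i < ?n" for i
  proof -
    show a: "Suc (prv i) mod ?n = i" using that n by (simp add: prv_def mod_Suc_eq)
    show "prv i < ?n" using n by (simp add: prv_def)
    show "prv i \<noteq> Suc i mod ?n"
    proof
      assume "prv i = Suc i mod ?n"
      hence "Suc (Suc i mod ?n) mod ?n = i" using a by simp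
      hence "(i + 2) mod ?n = i" by (simp add: mod_Suc_eq)
      thus False using that assms(2) by (cases "i + 2 < ?n") (auto simp: mod_if split: if_splits)
    qed
  qed
  have nbr: "w = xs ! (Suc i mod ?n) \<or> w = xs ! prv i" if "i < ?n" "E (xs ! i) w" for i w
    using third_neighbour[of "xs ! i" "xs ! (Suc i mod ?n)" "xs ! prv i" w] edge[OF that(1)]
      edge[of "prv i"] prv[OF that(1)] dist[of "Suc i mod ?n" "prv i"] n that(2) E_sym
    by (metis mod_less_divisor)
  have edge_iff: "E (xs ! i) (xs ! j) \<longleftrightarrow> j = (i + 1) mod ?n \<or> i = (j + 1) mod ?n"
    if "i < ?n" "j < ?n" for i j
  proof
    assume "E (xs ! i) (xs ! j)"
    hence "j = Suc i mod ?n \<or> j = prv i" using nbr[of i "xs ! j"] that dist prv(2) n by (metis mod_less_divisor)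
    thus "j = (i + 1) mod ?n \<or> i = (j + 1) mod ?n" using prv(1)[OF that(1)] by auto
  next
    assume "j = (i + 1) mod ?n \<or> i = (j + 1) mod ?n"
    thus "E (xs ! i) (xs ! j)" using edge[OF that(1)] edge[OF that(2)] E_sym by auto
  qed
  have closed: "w \<in> set xs" if u: "u \<in> set xs" "E u w" for u w
  proof -
    obtain i where "i < ?n" "u = xs ! i" using u by (metis in_set_conv_nth)
    thus ?thesis using nbr[of i w] u prv(2)[of i] n by (auto simp: nth_mem)
  qed
  have reach: "E\<^sup>*\<^sup>* (xs ! 0) (xs ! i)" if "i < ?n" for i
    using that
  proof (induction i)
    case (Suc i)
    thus ?case using edge[of i] by (auto intro: rtranclp.rtrancl_into_rtrancl)
  qed simp
  have "w \<in> set xs" if "E\<^sup>*\<^sup>* (xs ! 0) w" for w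
    using that by (induction rule: rtranclp_induct) (use closed n in auto)
  moreover have "set xs \<subseteq> V" using edge E_V by (metis in_set_conv_nth subsetI)
  ultimately have "set xs = component V E (xs ! 0)"
    unfolding component_def using reach by (auto simp: in_set_conv_nth)
  thus ?thesis unfolding is_cycle_component_def
    using \<open>set xs \<subseteq> V\<close> n assms edge_iff
    by (intro conjI bexI[of _ "xs ! 0"] exI[of _ xs]) auto
qed

text \<open>The list may be a strand of a subgraph \<open>F\<close>: once it closes up in
  \<open>E\<close>, every vertex has its two neighbours in it, so it is a whole component of
  \<open>E\<close>.\<close>

lemma strand_cycle_component:
  assumes xs: "strand F xs" "length xs \<ge> 3" "E (xs ! (length xs - 1)) (xs ! 0)"
    and F: "\<And>u v. F u v \<Longrightarrow> E u v"
  shows "is_cycle_component V E (set xs)"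
    and "i < length xs \<Longrightarrow> E (xs ! i) (xs ! (Suc i mod length xs))"
proof -
  show edge: "E (xs ! i) (xs ! (Suc i mod length xs))" if "i < length xs" for i
  proof (cases "Suc i < length xs")
    case True
    thus ?thesis using xs(1) F by (simp add: strand_def)
  next
    case False
    hence "Suc i = length xs" using that by simp
    hence "i = length xs - 1" "Suc i mod length xs = 0" by auto
    thus ?thesis using xs(3) by simp
  qed
  show "is_cycle_component V E (set xs)"
    using xs(1,2) edge by (intro cycle_component) (auto simp: strand_def)
qed

lemma component_closed: "x \<in> component V E v \<Longrightarrow> E x y \<Longrightarrow> y \<in> component V E v"
  using E_V by (auto simp: component_def intro: rtranclp.rtrancl_into_rtrancl)

lemma cycle_component_subset: "is_cycle_component V E C \<Longrightarrow> C \<subseteq> V"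
  by (auto simp: is_cycle_component_def component_def)

lemma cycle_component_closed: "is_cycle_component V E C \<Longrightarrow> x \<in> C \<Longrightarrow> E x y \<Longrightarrow> y \<in> C"
  using component_closed by (auto simp: is_cycle_component_def)

lemma cycle_components_disjoint:
  assumes "is_cycle_component V E C" "is_cycle_component V E D" "C \<noteq> D"
  shows "C \<inter> D = {}"
proof -
  obtain c d where c: "C = component V E c" and d: "D = component V E d"
    using assms by (auto simp: is_cycle_component_def)
  have sym: "E\<^sup>*\<^sup>* y x" if "E\<^sup>*\<^sup>* x y" for x y
    using that by (induction rule: rtranclp_induct) (auto intro: converse_rtranclp_into_rtranclp E_sym)
  have "component V E c = component V E d" if "z \<in> C" "z \<in> D" for z
  proof -
    have "E\<^sup>*\<^sup>* c z" "E\<^sup>*\<^sup>* d z" using that by (auto simp: c d component_def)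
    hence "E\<^sup>*\<^sup>* c d" "E\<^sup>*\<^sup>* d c" using sym rtranclp_trans by metis+
    thus ?thesis unfolding component_def by (auto intro: rtranclp_trans)
  qed
  thus ?thesis using assms(3) c d by blast
qed

lemma finite_cycle_components: "finite {C. is_cycle_component V E C}"
  using finite_V cycle_component_subset by (rule_tac finite_subset[of _ "Pow V"]) auto

lemma card_cycle_component:
  assumes "is_cycle_component V E C"
  shows "card C \<ge> 4 \<or> card C = 3 \<and> C \<in> triangles V E"
proof -
  obtain xs where xs: "distinct xs" "set xs = C" "length xs \<ge> 3"
    "\<And>i j. i < length xs \<Longrightarrow> j < length xs \<Longrightarrow> E (xs ! i) (xs ! j) \<longleftrightarrow>
      j = (i + 1) mod length xs \<or> i = (j + 1) mod length xs"
    using assms unfolding is_cycle_component_def by metis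
  have len: "card C = length xs" using xs distinct_card by metis
  show ?thesis
  proof (cases "length xs = 3")
    case True
    have "E u w" if uw: "u \<in> C" "w \<in> C" "u \<noteq> w" for u w
    proof -
      obtain i where i: "i < 3" "u = xs ! i" using uw xs(2) True by (auto simp: in_set_conv_nth)
      obtain j where j: "j < 3" "w = xs ! j" using uw xs(2) True by (auto simp: in_set_conv_nth)
      have ij: "i < 3" "j < 3" "u = xs ! i" "w = xs ! j" "i \<noteq> j" using i j uw by auto
      hence "j = (i + 1) mod 3 \<or> i = (j + 1) mod 3"
      proof -
        have "i = 0 \<or> i = 1 \<or> i = 2" "j = 0 \<or> j = 1 \<or> j = 2" using ij by auto
        thus ?thesis using ij(5) by (elim disjE) simp_all
      qed
      thus ?thesis using xs(4)[of i j] True ij by auto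
    qed
    thus ?thesis using len True cycle_component_subset[OF assms] by (simp add: triangles_def)
  qed (use len xs(3) in auto)
qed

lemma finite_triangles: "finite (triangles V E)"
  using finite_V by (rule_tac finite_subset[of _ "Pow V"]) (auto simp: triangles_def)

end

section \<open>Few triangles\<close>

text \<open>Serves the vertices outside all sets \<open>Y j\<close>: each has fewer than
  \<open>k\<close> neighbours, so one of the \<open>k\<close> colours remains for it.\<close>

lemma greedy_extension:
  fixes c :: "'a \<Rightarrow> nat"
  assumes "finite U" and "\<And>u. u \<in> U \<Longrightarrow> finite {w. G u w} \<and> card {w. G u w} < k"
    and sym: "\<And>u v. G u v \<Longrightarrow> G v u" and irrefl: "\<And>v. \<not> G v v"
    and "\<forall>v\<in>W. c v < k" "\<forall>u\<in>W. \<forall>v\<in>W. G u v \<longrightarrow> c u \<noteq> c v"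
  shows "\<exists>c' :: 'a \<Rightarrow> nat. (\<forall>v\<in>W \<union> U. c' v < k) \<and> (\<forall>u\<in>W \<union> U. \<forall>v\<in>W \<union> U. G u v \<longrightarrow> c' u \<noteq> c' v)"
  using assms(1,2)
proof (induction U rule: finite_induct)
  case empty
  thus ?case using assms(5,6) by auto
next
  case (insert u U)
  then obtain c' :: "'a \<Rightarrow> nat" where c': "\<forall>v\<in>W \<union> U. c' v < k"
    "\<forall>x\<in>W \<union> U. \<forall>y\<in>W \<union> U. G x y \<longrightarrow> c' x \<noteq> c' y" by auto
  show ?case
  proof (cases "u \<in> W")
    case True
    thus ?thesis using c' by (intro exI[of _ c']) (simp add: insert_absorb)
  next
    case False
    have "card (c' ` {w. G u w}) < card {..<k}"
      using insert.prems[of u] card_image_le[of "{w. G u w}" c'] by simp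
    hence "\<not> {..<k} \<subseteq> c' ` {w. G u w}"
      using insert.prems[of u] by (metis card_mono finite_imageI insertI1 not_less)
    then obtain x where x: "x < k" "x \<notin> c' ` {w. G u w}" by auto
    show ?thesis
    proof (intro exI[of _ "c'(u := x)"] conjI ballI impI)
      fix v assume "v \<in> W \<union> insert u U"
      thus "(c'(u := x)) v < k" using c'(1) x(1) by auto
    next
      fix v w assume v: "v \<in> W \<union> insert u U" and w: "w \<in> W \<union> insert u U" and G: "G v w"
      consider "v = u" | "w = u" | "v \<noteq> u" "w \<noteq> u" by blast
      thus "(c'(u := x)) v \<noteq> (c'(u := x)) w"
      proof cases
        case 1
        hence "w \<noteq> u" using G irrefl by auto
        thus ?thesis using 1 G x(2) by auto
      next
        case 2
        hence "v \<noteq> u" using G irrefl by auto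
        thus ?thesis using 2 sym[OF G] x(2) by auto
      next
        case 3
        thus ?thesis using c'(2) v w G by auto
      qed
    qed
  qed
qed

text \<open>Allows all strands to be coloured as a single path: concatenation keeps their edges and
  only adds constraints.\<close>

lemma adjacent_in_concat:
  assumes "xs \<in> set Ls" "Suc i < length xs"
  shows "\<exists>k. Suc k < length (concat Ls) \<and> concat Ls ! k = xs ! i \<and> concat Ls ! Suc k = xs ! Suc i"
  using assms(1)
proof (induction Ls)
  case (Cons ys Ls)
  show ?case
  proof (cases "xs = ys")
    case True
    thus ?thesis using assms(2) by (intro exI[of _ i]) (auto simp: nth_append)
  next
    case False
    then obtain k where "Suc k < length (concat Ls)" "concat Ls ! k = xs ! i" "concat Ls ! Suc k = xs ! Suc i"
      using Cons by auto
    thus ?thesis by (intro exI[of _ "length ys + k"]) (auto simp: nth_append)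
  qed
qed simp

context degree_two_graph
begin

lemma degree_two_subgraph:
  assumes "V' \<subseteq> V" and "\<And>u v. E' u v \<Longrightarrow> E u v \<and> u \<in> V' \<and> v \<in> V'" and "\<And>u v. E' u v \<Longrightarrow> E' v u"
  shows "degree_two_graph V' E'"
proof
  show "simple_graph V' E'"
    using assms finite_subset[OF assms(1) finite_V] E_irrefl unfolding simple_graph_def by blast
  have "card {w. E' v w} \<le> 2" if "v \<in> V'" for v
  proof -
    have "finite {w. E v w}" using finite_V E_V by (rule_tac finite_subset[of _ V]) auto
    hence "card {w. E' v w} \<le> card {w. E v w}" using assms(2) by (intro card_mono) auto
    also have "\<dots> \<le> 2" using degree that assms(1) by (auto simp: max_degree_le_def degree_def)
    finally show ?thesis .
  qed
  thus "max_degree_le V' E' 2" by (simp add: max_degree_le_def degree_def)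
qed

text \<open>A transversal meeting every cycle leaves only paths and turns each \<open>Y j\<close>
  into a triple, so \<open>path_plus_triangles\<close> applies to the concatenated strands.\<close>

lemma three_colouring:
  fixes q :: nat and Y :: "nat \<Rightarrow> 'a set" and s :: "nat \<Rightarrow> 'a"
  assumes cover: "V = (\<Union>j<q. Y j)" and card_Y: "\<forall>j<q. card (Y j) = 4"
    and disj: "\<forall>i<q. \<forall>j<q. i \<noteq> j \<longrightarrow> Y i \<inter> Y j = {}" and s: "\<forall>j<q. s j \<in> Y j"
    and hit: "\<And>C. is_cycle_component V E C \<Longrightarrow> \<exists>j<q. s j \<in> C"
  defines "S \<equiv> s ` {..<q}"
  shows "\<exists>c :: 'a \<Rightarrow> nat. (\<forall>v\<in>V - S. c v < 3) \<and> (\<forall>u\<in>V - S. \<forall>v\<in>V - S. E u v \<longrightarrow> c u \<noteq> c v)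
    \<and> (\<forall>j<q. inj_on c (Y j - {s j}))"
proof -
  define E' where "E' u v \<longleftrightarrow> E u v \<and> u \<notin> S \<and> v \<notin> S" for u v
  interpret sub: degree_two_graph "V - S" E'
    by (rule degree_two_subgraph) (use E_V E_sym in \<open>unfold E'_def, blast+\<close>)
  obtain Ls where Ls: "\<And>xs. xs \<in> set Ls \<Longrightarrow> strand E' xs" "distinct (concat Ls)" "set (concat Ls) = V - S"
    using sub.strand_decomposition by blast
  have sY: "s i \<in> Y j \<longleftrightarrow> i = j" if "i < q" "j < q" for i j
    using disj s that by blast
  have "set (concat Ls) = (\<Union>j<q. Y j - {s j})"
    unfolding Ls(3) cover S_def using sY by (auto simp del: UN_simps)
  moreover have "\<forall>j<q. card (Y j - {s j}) = 3"
    using card_Y s by (simp add: card_Diff_singleton)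
  moreover have "\<forall>i<q. \<forall>j<q. i \<noteq> j \<longrightarrow> (Y i - {s i}) \<inter> (Y j - {s j}) = {}" using disj by blast
  ultimately obtain c :: "'a \<Rightarrow> nat" where c: "\<forall>v\<in>V - S. c v < 3"
    "\<And>k. Suc k < length (concat Ls) \<Longrightarrow> c (concat Ls ! k) \<noteq> c (concat Ls ! Suc k)"
    "\<forall>j<q. inj_on c (Y j - {s j})"
    using path_plus_triangles[OF Ls(2), of q "\<lambda>j. Y j - {s j}"] unfolding Ls(3) by blast
  have adj: "c (xs ! i) \<noteq> c (xs ! Suc i)" if "xs \<in> set Ls" "Suc i < length xs" for xs i
    using adjacent_in_concat[OF that] c(2) by metis
  \<comment> \<open>A closing strand would be a cycle component of the whole graph, hence contain a
    deleted vertex.\<close>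
  have closing: "\<not> E (xs ! 0) (xs ! (length xs - 1))" if xs: "xs \<in> set Ls" "length xs \<ge> 3" for xs
  proof
    assume close: "E (xs ! 0) (xs ! (length xs - 1))"
    have "is_cycle_component V E (set xs)"
      by (rule strand_cycle_component(1)[OF Ls(1)[OF xs(1)] xs(2) E_sym[OF close]])
        (simp add: E'_def)
    then obtain j where "j < q" "s j \<in> set xs" using hit by blast
    moreover have "set xs \<subseteq> V - S" using xs(1) Ls(3) by auto
    ultimately show False by (auto simp: S_def)
  qed
  have "c u \<noteq> c v" if u: "u \<in> V - S" and v: "v \<in> V - S" and uv: "E u v" for u v
  proof -
    obtain xs where xs: "xs \<in> set Ls" "u \<in> set xs" using u Ls(3) by auto
    obtain i where i: "i < length xs" "u = xs ! i" using xs(2) by (auto simp: in_set_conv_nth)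
    have "E' (xs ! i) v" using u v uv i by (simp add: E'_def)
    then obtain j where j: "j < length xs" "v = xs ! j"
      "j = Suc i \<or> i = Suc j \<or> i = 0 \<and> Suc j = length xs \<or> j = 0 \<and> Suc i = length xs"
      using Ls(1)[OF xs(1)] i unfolding strand_def by blast
    have ij: "i \<noteq> j" using uv i j E_irrefl by metis
    from j(3) show ?thesis
    proof (elim disjE conjE)
      assume "i = 0" "Suc j = length xs"
      hence "\<not> length xs \<ge> 3" using closing[OF xs(1)] uv i j by (metis diff_Suc_1)
      hence "j = Suc i" using ij \<open>i = 0\<close> \<open>Suc j = length xs\<close> by linarith
      thus ?thesis using adj[OF xs(1), of i] i j by auto
    next
      assume "j = 0" "Suc i = length xs"
      hence "\<not> length xs \<ge> 3" using closing[OF xs(1)] E_sym[OF uv] i j by (metis diff_Suc_1)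
      hence "i = Suc j" using ij \<open>j = 0\<close> \<open>Suc i = length xs\<close> by linarith
      thus ?thesis using adj[OF xs(1), of j] i j by auto
    qed (use adj[OF xs(1), of i] adj[OF xs(1), of j] i j in auto)
  qed
  thus ?thesis using c by blast
qed

text \<open>A cycle with at least 4 vertices pays for itself, and each of the at most 3 triangles
  falls short by one.\<close>

lemma cycle_components_large:
  assumes few: "card (triangles V E) \<le> 3" and sub: "\<D> \<subseteq> {C. is_cycle_component V E C}"
  shows "4 * card \<D> \<le> card (\<Union>\<D>) + 3"
proof -
  have fin: "finite \<D>" using sub finite_cycle_components finite_subset by blast
  have "card {C \<in> \<D>. card C = 3} \<le> card (triangles V E)"
    using sub card_cycle_component by (intro card_mono finite_triangles) fastforce
  moreover have "(\<Sum>C\<in>\<D>. 4) \<le> (\<Sum>C\<in>\<D>. card C + of_bool (card C = 3))"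
    using sub card_cycle_component by (intro sum_mono) fastforce
  hence "4 * card \<D> \<le> (\<Sum>C\<in>\<D>. card C) + card {C \<in> \<D>. card C = 3}"
    using fin by (simp add: sum.distrib Int_def)
  moreover have "card (\<Union>\<D>) = (\<Sum>C\<in>\<D>. card C)"
  proof (rule card_Union_disjoint)
    show "pairwise disjnt \<D>" using sub cycle_components_disjoint by (auto simp: pairwise_def disjnt_def)
    show "\<And>C. C \<in> \<D> \<Longrightarrow> finite C" using sub cycle_component_subset finite_V finite_subset by blast
  qed
  ultimately show ?thesis using few by linarith
qed

lemma four_colouring_few_triangles:
  assumes cover: "V = (\<Union>j<q. Y j)" and card_Y: "\<forall>j<q. card (Y j) = 4"
    and disj: "\<forall>i<q. \<forall>j<q. i \<noteq> j \<longrightarrow> Y i \<inter> Y j = {}"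
    and few: "card (triangles V E) \<le> 3"
  shows "\<exists>c :: 'a \<Rightarrow> nat. (\<forall>v\<in>V. c v < 4) \<and> (\<forall>u v. glue_K4 E q Y u v \<longrightarrow> c u \<noteq> c v)"
proof -
  let ?\<C> = "{C. is_cycle_component V E C}"
  \<comment> \<open>Used twice: with the empty relation \<open>F\<close>, where any transversal can
    start, and with \<open>F = E\<close>, which preserves independence.\<close>
  have hitting: "\<exists>s. (\<forall>j<q. s j \<in> Y j) \<and> (\<forall>i<q. \<forall>j<q. \<not> F (s i) (s j)) \<and> (\<forall>C\<in>?\<C>. \<exists>j<q. s j \<in> C)"
    if "\<And>u v. F u v \<Longrightarrow> E u v" "\<And>u v. F u v \<Longrightarrow> F v u"
      "\<forall>j<q. s0 j \<in> Y j" "\<forall>i<q. \<forall>j<q. \<not> F (s0 i) (s0 j)" for F and s0 :: "nat \<Rightarrow> 'a"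
  proof (rule hitting_transversal[OF card_Y finite_cycle_components])
    show "\<forall>C\<in>?\<C>. \<forall>D\<in>?\<C>. C \<noteq> D \<longrightarrow> C \<inter> D = {}" using cycle_components_disjoint by blast
    show "\<forall>C\<in>?\<C>. C \<subseteq> (\<Union>j<q. Y j)" using cycle_component_subset cover by blast
    show "\<forall>C\<in>?\<C>. \<forall>x\<in>C. \<forall>y. F x y \<longrightarrow> y \<in> C" using cycle_component_closed that(1) by blast
    show "\<forall>\<D>\<subseteq>?\<C>. 4 * card \<D> \<le> card (\<Union>\<D>) + 3" using cycle_components_large[OF few] by blast
    show "\<forall>x y. F x y \<longrightarrow> F y x" using that(2) by blast
    show "\<forall>x. \<not> F x x" using that(1) E_irrefl by blast
  qed fact+
  have "\<exists>v. j < q \<longrightarrow> v \<in> Y j" for j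
    using card_Y by (metis card.empty equals0I zero_neq_numeral)
  then obtain s0 where s0: "\<forall>j<q. s0 j \<in> Y j" by metis
  have "\<exists>s. (\<forall>j<q. s j \<in> Y j) \<and> (\<forall>i<q. \<forall>j<q. \<not> False) \<and> (\<forall>C\<in>?\<C>. \<exists>j<q. s j \<in> C)"
    by (rule hitting[of "\<lambda>_ _. False" s0]) (simp_all add: s0)
  then obtain s1 where s1: "\<forall>j<q. s1 j \<in> Y j" "\<And>C. is_cycle_component V E C \<Longrightarrow> \<exists>j<q. s1 j \<in> C"
    by auto
  obtain c1 :: "'a \<Rightarrow> nat" where c1: "\<forall>v\<in>V - s1 ` {..<q}. c1 v < 3"
    "\<forall>u\<in>V - s1 ` {..<q}. \<forall>v\<in>V - s1 ` {..<q}. E u v \<longrightarrow> c1 u \<noteq> c1 v"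
    "\<forall>j<q. inj_on c1 (Y j - {s1 j})"
    using three_colouring[OF cover card_Y disj s1] by blast
  have in_V: "Y j - {s1 j} \<subseteq> V - s1 ` {..<q}" if "j < q" for j
    using s1(1) disj that cover by (auto simp: disjoint_iff)
  \<comment> \<open>All three colours occur in each triple, so colour class 0 contains a
    transversal.\<close>
  have "\<exists>v\<in>Y j - {s1 j}. c1 v = 0" if "j < q" for j
  proof -
    have "c1 ` (Y j - {s1 j}) = {..<3}"
    proof (rule card_subset_eq)
      show "c1 ` (Y j - {s1 j}) \<subseteq> {..<3}" using c1(1) in_V[OF that] by auto
      show "card (c1 ` (Y j - {s1 j})) = card {..<3::nat}"
        using c1(3) that s1(1) card_Y by (simp add: card_image card_Diff_singleton)
    qed simp
    hence "0 \<in> c1 ` (Y j - {s1 j})" by simp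
    thus ?thesis by (metis imageE)
  qed
  then obtain s2 where s2: "\<And>j. j < q \<Longrightarrow> s2 j \<in> Y j - {s1 j} \<and> c1 (s2 j) = 0" by metis
  have "\<forall>i<q. \<forall>j<q. \<not> E (s2 i) (s2 j)"
    using c1(2) s2 in_V by (metis subsetD)
  hence "\<exists>s. (\<forall>j<q. s j \<in> Y j) \<and> (\<forall>i<q. \<forall>j<q. \<not> E (s i) (s j)) \<and> (\<forall>C\<in>?\<C>. \<exists>j<q. s j \<in> C)"
    by (intro hitting[of E s2]) (use s2 E_sym in auto)
  then obtain s3 where s3: "\<forall>j<q. s3 j \<in> Y j" "\<forall>i<q. \<forall>j<q. \<not> E (s3 i) (s3 j)"
    "\<And>C. is_cycle_component V E C \<Longrightarrow> \<exists>j<q. s3 j \<in> C"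
    by auto
  let ?S = "s3 ` {..<q}"
  obtain c3 :: "'a \<Rightarrow> nat" where c3: "\<forall>v\<in>V - ?S. c3 v < 3"
    "\<forall>u\<in>V - ?S. \<forall>v\<in>V - ?S. E u v \<longrightarrow> c3 u \<noteq> c3 v"
    "\<forall>j<q. inj_on c3 (Y j - {s3 j})"
    using three_colouring[OF cover card_Y disj s3(1,3)] by blast
  define c where "c v = (if v \<in> ?S then 3 else c3 v)" for v
  have S_Y: "v \<in> ?S \<longleftrightarrow> v = s3 j" if "v \<in> Y j" "j < q" for v j
    using disj s3(1) that by auto
  have small: "c v < 3" if "v \<in> V - ?S" for v using c3(1) that by (simp add: c_def)
  have sep: "c u \<noteq> c v" if "u \<in> V" "v \<in> V" "u \<in> ?S \<longleftrightarrow> v \<notin> ?S" for u v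
    using small[of u] small[of v] that by (auto simp: c_def)
  have "c u \<noteq> c v" if uv: "glue_K4 E q Y u v" for u v
  proof -
    consider "E u v" | j where "u \<noteq> v" "j < q" "u \<in> Y j" "v \<in> Y j"
      using uv by (auto simp: glue_K4_def)
    thus ?thesis
    proof cases
      case 1
      hence V: "u \<in> V" "v \<in> V" using E_V by auto
      have "\<not> (u \<in> ?S \<and> v \<in> ?S)" using s3(2) 1 by auto
      moreover have "c u \<noteq> c v" if "u \<notin> ?S" "v \<notin> ?S" using c3(2) that 1 V by (simp add: c_def)
      ultimately show ?thesis using sep V by blast
    next
      case 2
      hence V: "u \<in> V" "v \<in> V" using cover by auto
      have "\<not> (u \<in> ?S \<and> v \<in> ?S)" using S_Y[OF 2(3,2)] S_Y[OF 2(4,2)] 2(1) by metis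
      moreover have "c u \<noteq> c v" if "u \<notin> ?S" "v \<notin> ?S"
      proof -
        have "u \<in> Y j - {s3 j}" "v \<in> Y j - {s3 j}" using that S_Y 2 by auto
        hence "c3 u \<noteq> c3 v" using c3(3) 2 by (meson inj_onD)
        thus ?thesis using that by (simp add: c_def)
      qed
      ultimately show ?thesis using sep V by blast
    qed
  qed
  moreover have "\<forall>v\<in>V. c v < 4" using c3(1) by (force simp: c_def)
  ultimately show ?thesis by blast
qed

text \<open>On the union \<open>V'\<close> of the sets \<open>Y j\<close> the previous lemma
  applies. Every other vertex still has degree at most 2 after the gluing, so greedy extension
  finishes.\<close>

theorem colouring_few_triangles:
  assumes Y: "\<forall>j<q. Y j \<subseteq> V \<and> card (Y j) = 4"
    and disj: "\<forall>i<q. \<forall>j<q. i \<noteq> j \<longrightarrow> Y i \<inter> Y j = {}"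
    and few: "card (triangles V E) \<le> 3"
  shows "\<exists>c. proper_colouring V (glue_K4 E q Y) 4 c"
proof -
  define V' where "V' = (\<Union>j<q. Y j)"
  define E' where "E' u v \<longleftrightarrow> E u v \<and> u \<in> V' \<and> v \<in> V'" for u v
  have V': "V' \<subseteq> V" using Y by (auto simp: V'_def)
  interpret sub: degree_two_graph V' E'
    by (rule degree_two_subgraph) (use V' E_sym in \<open>unfold E'_def, blast+\<close>)
  have "triangles V' E' \<subseteq> triangles V E" using V' by (auto simp: triangles_def E'_def)
  hence "card (triangles V' E') \<le> 3" using few card_mono[OF finite_triangles] by (meson le_trans)
  then obtain c :: "'a \<Rightarrow> nat" where c: "\<forall>v\<in>V'. c v < 4" "\<forall>u v. glue_K4 E' q Y u v \<longrightarrow> c u \<noteq> c v"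
    using sub.four_colouring_few_triangles[OF V'_def _ disj] Y by blast
  have glue_V: "u \<in> V" if "glue_K4 E q Y u v" for u v
    using that Y E_V by (auto simp: glue_K4_def)
  have glue_sym: "glue_K4 E q Y v u" if "glue_K4 E q Y u v" for u v
    using that E_sym unfolding glue_K4_def by blast
  have "\<exists>c'::'a \<Rightarrow> nat. (\<forall>v\<in>V' \<union> (V - V'). c' v < 4) \<and>
      (\<forall>u\<in>V' \<union> (V - V'). \<forall>v\<in>V' \<union> (V - V'). glue_K4 E q Y u v \<longrightarrow> c' u \<noteq> c' v)"
  proof (rule greedy_extension)
    fix u assume u: "u \<in> V - V'"
    have "{w. glue_K4 E q Y u w} = {w. E u w}" using u by (auto simp: glue_K4_def V'_def)
    moreover have "finite {w. E u w}" using finite_V E_V by (rule_tac finite_subset[of _ V]) auto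
    moreover have "card {w. E u w} \<le> 2" using degree u by (auto simp: max_degree_le_def degree_def)
    ultimately show "finite {w. glue_K4 E q Y u w} \<and> card {w. glue_K4 E q Y u w} < 4" by simp
  next
    show "\<forall>u\<in>V'. \<forall>v\<in>V'. glue_K4 E q Y u v \<longrightarrow> c u \<noteq> c v"
      using c(2) by (auto simp: glue_K4_def E'_def)
    show "\<not> glue_K4 E q Y v v" for v using E_irrefl by (simp add: glue_K4_def)
  qed (use finite_V glue_sym c(1) in blast)+
  moreover have "V' \<union> (V - V') = V" using V' by blast
  ultimately show ?thesis unfolding proper_colouring_def using glue_V glue_sym by metis
qed

end

section \<open>At most one long odd cycle\<close>

text \<open>A matching is encoded as an involution \<open>p\<close>: the orbits of size two are its
  pairs, the fixed points its unmatched vertices.\<close>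

definition separates :: "('a \<Rightarrow> bool) \<Rightarrow> ('a \<Rightarrow> 'a) \<Rightarrow> bool" where
  "separates f p \<longleftrightarrow> (\<forall>x. p x \<noteq> x \<longrightarrow> f (p x) \<noteq> f x)"

text \<open>For a matching given as a list of pairs, \<open>distinct (ends ms)\<close> says that no
  vertex is used twice.\<close>

definition ends :: "('a \<times> 'a) list \<Rightarrow> 'a list" where
  "ends ms = concat (map (\<lambda>(a, b). [a, b]) ms)"

lemma ends_simps [simp]:
  "ends [] = []" "ends ((a, b) # ms) = a # b # ends ms" "ends (ms @ ms') = ends ms @ ends ms'"
  by (simp_all add: ends_def)

lemma ex_involution:
  assumes "\<And>x y. R x y \<Longrightarrow> R y x" "\<And>x y z. R x y \<Longrightarrow> R x z \<Longrightarrow> y = z"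
  shows "\<exists>p. (\<forall>x. p (p x) = x) \<and> (\<forall>x y. R x y \<longrightarrow> p x = y) \<and> (\<forall>x. p x \<noteq> x \<longrightarrow> R x (p x))"
proof -
  define p where "p x = (if \<exists>y. R x y then THE y. R x y else x)" for x
  have p: "p x = y" if "R x y" for x y
  proof -
    have "(THE y. R x y) = y" using that assms(2) by blast
    thus ?thesis using that by (auto simp: p_def)
  qed
  have q: "p x = x" if "\<nexists>y. R x y" for x using that by (simp add: p_def)
  have "p (p x) = x" for x using p q assms(1) by (metis (full_types))
  moreover have "R x (p x)" if "p x \<noteq> x" for x using that p q by metis
  ultimately show ?thesis using p by blast
qed

text \<open>\<open>f\<close> holds at one chosen member of each orbit. Both members of an orbit make
  the same choice because their predicates are equal.\<close>

lemma ex_separating: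
  assumes "\<And>x. p (p x) = x"
  shows "\<exists>f. separates f p"
proof -
  define f where "f x \<longleftrightarrow> (SOME y. y = x \<or> y = p x) = x" for x
  have "f (p x) \<noteq> f x" if "p x \<noteq> x" for x
  proof -
    let ?s = "SOME y. y = x \<or> y = p x"
    have s: "?s = x \<or> ?s = p x" by (rule someI_ex) blast
    have "(\<lambda>y. y = p x \<or> y = p (p x)) = (\<lambda>y. y = x \<or> y = p x)" using assms by auto
    hence "f (p x) \<longleftrightarrow> ?s = p x" by (simp add: f_def)
    moreover have "f x \<longleftrightarrow> ?s = x" by (simp add: f_def)
    ultimately show ?thesis using s that by auto
  qed
  thus ?thesis unfolding separates_def by blast
qed

text \<open>Removes \<open>a\<close> and \<open>b\<close> from the matching and joins their
  partners, i.e. contracts the path \<open>p a\<close>, \<open>a\<close>, \<open>b\<close>,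
  \<open>p b\<close>. If only one of them has a partner, that partner becomes unmatched.\<close>

definition bypass :: "'a \<Rightarrow> 'a \<Rightarrow> ('a \<Rightarrow> 'a) \<Rightarrow> 'a \<Rightarrow> 'a" where
  "bypass a b p x = (if x = a \<or> x = b then x
     else if p x = a then (if p b = b then x else p b)
     else if p x = b then (if p a = a then x else p a) else p x)"

text \<open>If \<open>p a\<close> and \<open>p b\<close> differ under \<open>f\<close>, the opposite
  values at \<open>a\<close> and \<open>b\<close> differ as well, so the colouring extends along the
  contracted path.\<close>

lemma bypass:
  fixes p :: "'a \<Rightarrow> 'a"
  assumes p: "\<And>x. p (p x) = x" and ab: "a \<noteq> b"
  shows "bypass a b p (bypass a b p x) = x" and "\<And>f. separates f (bypass a b p) \<Longrightarrow>
      \<exists>g. (\<forall>x. x \<noteq> a \<longrightarrow> x \<noteq> b \<longrightarrow> g x = f x) \<and> separates g p \<and> g a \<noteq> g b"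
proof -
  have inj: "p x = p y \<longleftrightarrow> x = y" for x y using p by metis
  show "bypass a b p (bypass a b p x) = x"
  proof (cases "p a = b")
    case True
    hence "p y = a \<longleftrightarrow> y = b" "p y = b \<longleftrightarrow> y = a" for y using p inj by metis+
    thus ?thesis unfolding bypass_def by (auto simp: p)
  next
    case False
    hence ba: "p b \<noteq> a" using p by metis
    consider "x = a \<or> x = b" | "x \<noteq> a" "x \<noteq> b" "p x = a" | "x \<noteq> a" "x \<noteq> b" "p x = b"
      | "x \<noteq> a" "x \<noteq> b" "p x \<noteq> a" "p x \<noteq> b" by blast
    thus ?thesis
    proof cases
      case 2
      hence "p a = x" using p by metis
      thus ?thesis using 2 False ba ab p unfolding bypass_def by auto
    next
      case 3
      hence "p b = x" using p by metis
      thus ?thesis using 3 False ba ab p unfolding bypass_def by auto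
    qed (auto simp: bypass_def p)
  qed
  show "\<exists>g. (\<forall>x. x \<noteq> a \<longrightarrow> x \<noteq> b \<longrightarrow> g x = f x) \<and> separates g p \<and> g a \<noteq> g b"
    if f: "separates f (bypass a b p)" for f
  proof -
    have sep: "f (p x) \<noteq> f x" if "p x \<noteq> x" "x \<noteq> a" "x \<noteq> b" "p x \<noteq> a" "p x \<noteq> b" for x
    proof -
      have "bypass a b p x = p x" using that by (simp add: bypass_def)
      thus ?thesis using f that(1) unfolding separates_def by metis
    qed
    \<comment> \<open>A vertex with a partner elsewhere takes the opposite of the partner's value,
      an unmatched one the opposite of the other of \<open>a\<close> and \<open>b\<close>.
      \<open>True\<close> and \<open>False\<close> serve when neither has a partner
      elsewhere.\<close>
    define g where "g = f(a := (if p a = b then True else if p a \<noteq> a then \<not> f (p a)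
        else if p b \<noteq> b then f (p b) else True),
      b := (if p a = b then False else if p b \<noteq> b then \<not> f (p b)
        else if p a \<noteq> a then f (p a) else False))"
    have ab_ne: "g a \<noteq> g b"
    proof (cases "p a \<noteq> b \<and> p a \<noteq> a \<and> p b \<noteq> b")
      case True
      hence "p a \<noteq> a" "p a \<noteq> b" "p (p a) = a" "p b \<noteq> b" "p b \<noteq> p a" using p inj ab by auto
      hence "bypass a b p (p a) = p b" by (simp add: bypass_def)
      hence "f (p b) \<noteq> f (p a)" using f \<open>p b \<noteq> p a\<close> unfolding separates_def by metis
      thus ?thesis using True ab by (simp add: g_def)
    qed (use ab in \<open>auto simp: g_def\<close>)
    have ga: "g (p a) \<noteq> g a" if "p a \<noteq> a"
      using that ab ab_ne by (cases "p a = b") (auto simp: g_def)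
    have gb: "g (p b) \<noteq> g b" if "p b \<noteq> b"
    proof (cases "p b = a")
      case False
      hence "p a \<noteq> b" using p by metis
      thus ?thesis using that False by (simp add: g_def)
    qed (use ab_ne in simp)
    have "g (p x) \<noteq> g x" if "p x \<noteq> x" for x
    proof -
      consider "x = a" | "x = b" | "p x = a" | "p x = b" | "x \<noteq> a" "x \<noteq> b" "p x \<noteq> a" "p x \<noteq> b" by blast
      thus ?thesis
      proof cases
        case 3
        hence "x = p a" using p by metis
        thus ?thesis using ga 3 that by auto
      next
        case 4
        hence "x = p b" using p by metis
        thus ?thesis using gb 4 that by auto
      qed (use ga gb sep that in \<open>auto simp: g_def\<close>)
    qed
    thus ?thesis using ab_ne unfolding separates_def by (intro exI[of _ g]) (auto simp: g_def)
  qed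
qed

text \<open>The involution q joins the ends of the maximal paths that alternate between pairs of ms
  and pairs of p.\<close>

lemma alternating_paths:
  assumes "\<And>x. p (p x) = x" "distinct (ends ms)"
  shows "\<exists>q. (\<forall>x. q (q x) = x) \<and>
    (\<forall>f. separates f q \<longrightarrow>
      (\<exists>g. (\<forall>x. x \<notin> set (ends ms) \<longrightarrow> g x = f x) \<and> separates g p \<and> (\<forall>(a, b)\<in>set ms. g a \<noteq> g b)))"
  using assms
proof (induction ms arbitrary: p)
  case Nil
  thus ?case by (intro exI[of _ p]) auto
next
  case (Cons m ms)
  obtain a b where m: "m = (a, b)" by fastforce
  have ab: "a \<noteq> b" "a \<notin> set (ends ms)" "b \<notin> set (ends ms)" "distinct (ends ms)"
    using Cons.prems(2) by (auto simp: m)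
  let ?p' = "bypass a b p"
  note spl = bypass[OF Cons.prems(1) ab(1)]
  obtain q where q: "\<forall>x. q (q x) = x"
    "\<forall>f. separates f q \<longrightarrow> (\<exists>g. (\<forall>x. x \<notin> set (ends ms) \<longrightarrow> g x = f x) \<and> separates g ?p'
        \<and> (\<forall>(a, b)\<in>set ms. g a \<noteq> g b))"
    using Cons.IH[OF spl(1) ab(4)] by blast
  have "\<exists>h. (\<forall>x. x \<notin> set (ends (m # ms)) \<longrightarrow> h x = f x) \<and> separates h p \<and> (\<forall>(a, b)\<in>set (m # ms). h a \<noteq> h b)"
    if "separates f q" for f
  proof -
    obtain g where g: "\<forall>x. x \<notin> set (ends ms) \<longrightarrow> g x = f x" "separates g ?p'" "\<forall>(a, b)\<in>set ms. g a \<noteq> g b"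
      using q(2) \<open>separates f q\<close> by blast
    obtain h where h: "\<forall>x. x \<noteq> a \<longrightarrow> x \<noteq> b \<longrightarrow> h x = g x" "separates h p" "h a \<noteq> h b"
      using spl(2)[OF g(2)] by blast
    have "h c \<noteq> h d" if "(c, d) \<in> set ms" for c d
    proof -
      have "c \<in> set (ends ms)" "d \<in> set (ends ms)" using that by (auto simp: ends_def intro!: bexI[of _ "(c, d)"])
      hence "h c = g c" "h d = g d" using h(1) ab by metis+
      thus ?thesis using g(3) that by auto
    qed
    thus ?thesis using h g(1) by (intro exI[of _ h]) (auto simp: m)
  qed
  thus ?case using q(1) by (intro exI[of _ q]) blast
qed

lemma matching_list:
  assumes "finite {x. q x \<noteq> x}" "\<And>x. q (q x) = x"
  shows "\<exists>ms. distinct (ends ms) \<and> set (ends ms) \<subseteq> {x. q x \<noteq> x} \<and>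
    (\<forall>x. q x \<noteq> x \<longrightarrow> (x, q x) \<in> set ms \<or> (q x, x) \<in> set ms)"
  using assms
proof (induction "card {x. q x \<noteq> x}" arbitrary: q rule: less_induct)
  case less
  show ?case
  proof (cases "\<exists>x. q x \<noteq> x")
    case False
    thus ?thesis by (intro exI[of _ "[]"]) auto
  next
    case True
    then obtain a where a: "q a \<noteq> a" by blast
    define q' where "q' = q(a := a, q a := q a)"
    have inv: "q' (q' x) = x" for x using less.prems(2) unfolding q'_def by (metis fun_upd_apply)
    have supp: "{x. q' x \<noteq> x} = {x. q x \<noteq> x} - {a, q a}" by (auto simp: q'_def)
    have smaller: "card {x. q' x \<noteq> x} < card {x. q x \<noteq> x}"
      unfolding supp using a less.prems(1) by (intro psubset_card_mono) auto
    have "finite {x. q' x \<noteq> x}" unfolding supp using less.prems(1) by simp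
    from less.hyps[OF smaller this inv]
    obtain ms where ms: "distinct (ends ms)" "set (ends ms) \<subseteq> {x. q x \<noteq> x} - {a, q a}"
      "\<forall>x. q' x \<noteq> x \<longrightarrow> (x, q' x) \<in> set ms \<or> (q' x, x) \<in> set ms"
      unfolding supp by blast
    have "(x, q x) \<in> set ((a, q a) # ms) \<or> (q x, x) \<in> set ((a, q a) # ms)" if "q x \<noteq> x" for x
    proof (cases "x = a \<or> x = q a")
      case False
      hence "q' x = q x" by (simp add: q'_def)
      thus ?thesis using ms(3)[rule_format, of x] that by auto
    qed (use less.prems(2)[of a] in auto)
    moreover have "distinct (ends ((a, q a) # ms))" using ms(1,2) a by auto
    moreover have "set (ends ((a, q a) # ms)) \<subseteq> {x. q x \<noteq> x}" using ms(2) a less.prems(2)[of a] by auto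
    ultimately show ?thesis by blast
  qed
qed

text \<open>Contracting the pairs of \<open>q\<close> leaves an involution, which can always be
  separated.\<close>

lemma two_matchings:
  assumes "\<And>x. p (p x) = x" "\<And>x. q (q x) = x" "finite {x. q x \<noteq> x}"
  shows "\<exists>f. separates f p \<and> separates f q"
proof -
  obtain ms where ms: "distinct (ends ms)"
    "\<forall>x. q x \<noteq> x \<longrightarrow> (x, q x) \<in> set ms \<or> (q x, x) \<in> set ms"
    using matching_list[OF assms(3,2)] by blast
  obtain r where r: "\<forall>x. r (r x) = x" "\<forall>f. separates f r \<longrightarrow>
      (\<exists>g. (\<forall>x. x \<notin> set (ends ms) \<longrightarrow> g x = f x) \<and> separates g p \<and> (\<forall>(a, b)\<in>set ms. g a \<noteq> g b))"
    using alternating_paths[OF assms(1) ms(1)] by blast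
  obtain f0 where "separates f0 r" using ex_separating r(1) by blast
  then obtain g where g: "separates g p" "\<forall>(a, b)\<in>set ms. g a \<noteq> g b" using r(2) by blast
  have "separates g q" unfolding separates_def using g(2) ms(2) by blast
  thus ?thesis using g(1) by blast
qed

text \<open>Used for its contrapositive: on an odd cycle some vertex is not paired within the
  cycle.\<close>

lemma even_card_involution:
  assumes "finite C" "\<And>x. x \<in> C \<Longrightarrow> q x \<in> C \<and> q x \<noteq> x \<and> q (q x) = x"
  shows "even (card C)"
  using assms
proof (induction C rule: finite_psubset_induct)
  case (psubset C)
  show ?case
  proof (cases "C = {}")
    case False
    then obtain a where a: "a \<in> C" by blast
    note qa = psubset.prems[OF a]
    have "even (card (C - {a, q a}))"
    proof (rule psubset.IH)
      fix x assume x: "x \<in> C - {a, q a}"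
      hence "q x \<noteq> a" "q x \<noteq> q a" using psubset.prems[of x] qa by auto
      thus "q x \<in> C - {a, q a} \<and> q x \<noteq> x \<and> q (q x) = x" using x psubset.prems[of x] by auto
    qed (use a in auto)
    moreover have "card C = card (C - {a, q a}) + 2"
    proof -
      have "card {a, q a} = 2" using qa by (simp add: eq_commute)
      thus ?thesis
        using a qa psubset.hyps card_mono[of C "{a, q a}"] by (simp add: card_Diff_subset)
    qed
    ultimately show ?thesis by simp
  qed simp
qed

section \<open>Matching consecutive vertices along strands\<close>

fun pairs :: "'a list \<Rightarrow> ('a \<times> 'a) list" where
  "pairs (x # y # zs) = (x, y) # pairs zs"
| "pairs _ = []"

lemma ends_pairs: "\<exists>r. xs = ends (pairs xs) @ r"
  by (induction xs rule: pairs.induct) auto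

lemma set_ends_pairs: "set (ends (pairs xs)) \<subseteq> set xs"
  using ends_pairs[of xs] by (metis set_append sup_ge1)

lemma distinct_ends_pairs: "distinct xs \<Longrightarrow> distinct (ends (pairs xs))"
  using ends_pairs[of xs] by (metis distinct_append)

lemma distinct_ends_pairs_concat:
  "distinct (concat Ls) \<Longrightarrow> distinct (ends (concat (map pairs Ls))) \<and>
     set (ends (concat (map pairs Ls))) \<subseteq> set (concat Ls)"
proof (induction Ls)
  case (Cons xs Ls)
  thus ?case using set_ends_pairs[of xs] distinct_ends_pairs[of xs] by auto
qed simp

lemma nth_pairs: "even i \<Longrightarrow> Suc i < length xs \<Longrightarrow> (xs ! i, xs ! Suc i) \<in> set (pairs xs)"
proof (induction xs arbitrary: i rule: pairs.induct)
  case (1 x y zs)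
  show ?case
  proof (cases i)
    case (Suc k)
    then obtain l where "i = Suc (Suc l)" using 1 by (cases k) auto
    thus ?thesis using 1 by auto
  qed simp
qed auto

context degree_two_graph
begin

lemma neighbour_differs:
  assumes "E v w" "f v \<noteq> f w" "E v y" "E v z" "y \<noteq> z"
  shows "\<not> (f v = f y \<and> f v = f z)"
  using third_neighbour[OF assms(3,4,5,1)] assms(2) by auto

lemma paired_differs:
  assumes edge: "\<And>i. Suc i < length xs \<Longrightarrow> E (xs ! i) (xs ! Suc i)"
    and f: "\<forall>(a, b)\<in>set (pairs xs). f a \<noteq> (f b :: bool)"
    and i: "i < length xs" "Suc i < length xs \<or> odd i" and "E (xs ! i) y" "E (xs ! i) z" "y \<noteq> z"
  shows "\<not> (f (xs ! i) = f y \<and> f (xs ! i) = f z)"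
proof (cases "even i")
  case True
  hence "Suc i < length xs" using i by simp
  moreover from this have "f (xs ! i) \<noteq> f (xs ! Suc i)" using nth_pairs[OF True] f by auto
  ultimately show ?thesis using neighbour_differs[of "xs ! i" "xs ! Suc i" f, OF edge] assms(5-7) by blast
next
  case False
  then obtain k where k: "i = Suc k" "even k" by (cases i) auto
  hence "E (xs ! i) (xs ! k)" using edge[of k] i(1) E_sym by blast
  moreover have "f (xs ! i) \<noteq> f (xs ! k)" using nth_pairs[of k xs] k i(1) f by auto
  ultimately show ?thesis using neighbour_differs[of "xs ! i" "xs ! k" f] assms(5-7) by blast
qed

text \<open>Only the last entry of an odd list is unpaired. It has two neighbours only if the strand
  closes up, and then \<open>ok\<close> leaves a triangle, where the two neighbours are partners and
  so have different values.\<close>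

lemma strand_differs:
  assumes xs: "strand E xs" and f: "\<forall>(a, b)\<in>set (pairs xs). f a \<noteq> (f b :: bool)"
    and ok: "even (length xs) \<or> length xs \<le> 3 \<or> \<not> E (xs ! (length xs - 1)) (xs ! 0)"
    and v: "v \<in> set xs" and yz: "E v y" "E v z" "y \<noteq> z"
  shows "\<not> (f v = f y \<and> f v = f z)"
proof -
  have edge: "\<And>i. Suc i < length xs \<Longrightarrow> E (xs ! i) (xs ! Suc i)" using xs by (simp add: strand_def)
  obtain i where i: "i < length xs" "v = xs ! i" using v by (auto simp: in_set_conv_nth)
  show ?thesis
  proof (cases "Suc i < length xs \<or> odd i")
    case True
    thus ?thesis using paired_differs[OF edge f i(1)] i(2) yz by auto
  next
    case False
    hence len: "Suc i = length xs" "even i" using i by auto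
    have nbr: "w = xs ! (i - 1) \<and> i > 0 \<or> w = xs ! 0 \<and> E (xs ! i) (xs ! 0)" if "E v w" for w
    proof -
      obtain j where j: "j < length xs" "w = xs ! j"
        "j = Suc i \<or> i = Suc j \<or> i = 0 \<and> Suc j = length xs \<or> j = 0 \<and> Suc i = length xs"
        using xs i \<open>E v w\<close> unfolding strand_def by blast
      from j(3) show ?thesis
      proof (elim disjE conjE)
        assume "i = 0" "Suc j = length xs"
        hence "j = i" using len by simp
        thus ?thesis using \<open>E v w\<close> j(2) i(2) E_irrefl by auto
      qed (use j len \<open>E v w\<close> i(2) in auto)
    qed
    have close: "E (xs ! i) (xs ! 0)" "i - 1 \<noteq> 0" "{y, z} = {xs ! (i - 1), xs ! 0}"
      using nbr[OF yz(1)] nbr[OF yz(2)] yz(3) by auto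
    have "i = length xs - 1" using len by simp
    hence "length xs = 3" using close ok len by auto
    hence "i = 2" using len by simp
    moreover have "f (xs ! 0) \<noteq> f (xs ! 1)" using nth_pairs[of 0 xs] f \<open>length xs = 3\<close> by auto
    ultimately show ?thesis using close(3) by (auto simp: doubleton_eq_iff)
  qed
qed

lemma alternating_colouring:
  assumes p: "\<And>x. p (p x) = x"
    and few: "card {C. is_cycle_component V E C \<and> odd (card C) \<and> card C > 3} \<le> 1"
  shows "\<exists>f. separates f p \<and> (\<forall>v y z. E v y \<longrightarrow> E v z \<longrightarrow> y \<noteq> z \<longrightarrow> \<not> (f v = f y \<and> f v = f z))"
proof -
  obtain Ls where Ls: "\<And>xs. xs \<in> set Ls \<Longrightarrow> strand E xs" "distinct (concat Ls)" "set (concat Ls) = V"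
    using strand_decomposition by blast
  \<comment> \<open>The long odd cycles, of which the hypothesis leaves at most one; all other
    strands are matched right away by \<open>ms\<close>.\<close>
  define bad where
    "bad xs \<longleftrightarrow> odd (length xs) \<and> length xs > 3 \<and> E (xs ! (length xs - 1)) (xs ! 0)" for xs
  have disj: "set xs \<inter> set ys = {}" if "xs \<in> set Ls" "ys \<in> set Ls" "xs \<noteq> ys" for xs ys
    using Ls(2) that by (auto simp: distinct_concat_iff)
  have bad_cycle: "is_cycle_component V E (set xs) \<and> odd (card (set xs)) \<and> card (set xs) > 3"
    if "xs \<in> set Ls" "bad xs" for xs
    using that strand_cycle_component(1)[OF Ls(1)[of xs]] Ls(1)[of xs] distinct_card[of xs]
    by (auto simp: bad_def strand_def)
  have unique: "xs = ys" if xy: "xs \<in> set Ls" "ys \<in> set Ls" "bad xs" "bad ys" for xs ys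
  proof (rule ccontr)
    assume "xs \<noteq> ys"
    have "set xs \<noteq> {}" using xy by (auto simp: bad_def)
    hence "set xs \<noteq> set ys" using disj[OF xy(1,2) \<open>xs \<noteq> ys\<close>] by auto
    hence "card {set xs, set ys} = 2" by simp
    moreover have "card {set xs, set ys} \<le> card {C. is_cycle_component V E C \<and> odd (card C) \<and> card C > 3}"
      using bad_cycle xy finite_cycle_components by (intro card_mono) auto
    ultimately show False using few by simp
  qed
  define ms where "ms = concat (map pairs (filter (\<lambda>xs. \<not> bad xs) Ls))"
  have "distinct (concat (filter (\<lambda>xs. \<not> bad xs) Ls))"
    using Ls(2) by (induction Ls) auto
  from distinct_ends_pairs_concat[OF this]
  have ms: "distinct (ends ms)" "set (ends ms) \<subseteq> (\<Union>xs\<in>{xs \<in> set Ls. \<not> bad xs}. set xs)"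
    by (auto simp: ms_def)
  obtain q where q: "\<forall>x. q (q x) = x" "\<forall>f. separates f q \<longrightarrow>
      (\<exists>g. (\<forall>x. x \<notin> set (ends ms) \<longrightarrow> g x = f x) \<and> separates g p \<and> (\<forall>(a, b)\<in>set ms. g a \<noteq> g b))"
    using alternating_paths[OF p ms(1)] by blast
  have good: "\<not> (g v = g y \<and> g v = g z)"
    if "\<forall>(a, b)\<in>set ms. g a \<noteq> (g b :: bool)" "xs \<in> set Ls" "\<not> bad xs" "v \<in> set xs" "E v y" "E v z" "y \<noteq> z"
    for g xs v y z
  proof (rule strand_differs[OF Ls(1)])
    show "\<forall>(a, b)\<in>set (pairs xs). g a \<noteq> g b" using that(1-3) by (auto simp: ms_def)
  qed (use that in \<open>auto simp: bad_def\<close>)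
  have in_Ls: "\<exists>xs\<in>set Ls. v \<in> set xs" if "E v y" for v y
    using Ls(3) E_V[OF that] by auto
  show ?thesis
  proof (cases "\<exists>xs\<in>set Ls. bad xs")
    case False
    obtain f where "separates f q" using ex_separating q(1) by blast
    then obtain g where g: "separates g p" "\<forall>(a, b)\<in>set ms. g a \<noteq> g b" using q(2) by blast
    show ?thesis using g(1) good[OF g(2)] False in_Ls by (intro exI[of _ g]) metis
  next
    case True
    then obtain xs where xs: "xs \<in> set Ls" "bad xs" by blast
    let ?n = "length xs"
    have n: "odd ?n" "?n > 3" using xs(2) by (auto simp: bad_def)
    have dxs: "distinct xs" using Ls(1)[OF xs(1)] by (simp add: strand_def)
    have edge: "E (xs ! i) (xs ! (Suc i mod ?n))" if "i < ?n" for i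
      using strand_cycle_component(2)[OF Ls(1)[OF xs(1)]] xs(2) that by (auto simp: bad_def)
    have not_ms: "x \<notin> set (ends ms)" if "x \<in> set xs" for x
      using ms(2) disj xs that by blast
    \<comment> \<open>Odd size prevents \<open>q\<close> from pairing the cycle within itself, so
      some \<open>v\<close> is fixed by \<open>q\<close> or paired with a vertex off the cycle. Its
      value can be chosen without affecting the rest of the cycle.\<close>
    have "odd (card (set xs))" using distinct_card[OF dxs] n by simp
    then obtain v where v: "v \<in> set xs" "q v \<notin> set xs \<or> q v = v"
      using even_card_involution[of "set xs" q] q(1) by blast
    then obtain k where k: "k < ?n" "v = xs ! k" by (auto simp: in_set_conv_nth)
    \<comment> \<open>The cycle cut open at \<open>v\<close>: a path with an even number of
      vertices, so \<open>pairs ys\<close> matches all of it, beginning with a neighbour of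
      \<open>v\<close>.\<close>
    define ys where "ys = tl (rotate k xs)"
    have len_ys: "length ys = ?n - 1" by (simp add: ys_def)
    have rot: "rotate k xs ! i = xs ! ((k + i) mod ?n)" if "i < ?n" for i
      using that by (rule nth_rotate)
    have ys: "ys ! i = xs ! ((k + Suc i) mod ?n)" if "i < length ys" for i
      using that rot[of "Suc i"] len_ys by (simp add: ys_def nth_tl)
    have v_ys: "rotate k xs = v # ys"
    proof -
      have "0 < ?n" using k by linarith
      hence "rotate k xs ! 0 = v" using rot[of 0] k by simp
      moreover have "rotate k xs \<noteq> []" using k by auto
      ultimately show ?thesis by (cases "rotate k xs") (auto simp: ys_def)
    qed
    have set_ys: "set xs = insert v (set ys)" "v \<notin> set ys" "distinct ys"
      using arg_cong[OF v_ys, of set] arg_cong[OF v_ys, of distinct] dxs by auto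
    have edge_ys: "E (ys ! i) (ys ! Suc i)" if "Suc i < length ys" for i
    proof -
      have "(k + Suc i) mod ?n < ?n" using k by (intro mod_less_divisor) linarith
      from edge[OF this] show ?thesis using ys[of i] ys[of "Suc i"] that by (simp add: mod_Suc_eq)
    qed
    have edge_v: "E v (ys ! 0)" using edge[of k] k ys[of 0] len_ys n by simp
    have y0: "ys ! 0 \<in> set ys" using len_ys n by simp
    \<comment> \<open>Dissolving the pair of \<open>v\<close> frees the values at \<open>v\<close>
      and \<open>q v\<close>, neither of which lies in \<open>ys\<close>.\<close>
    define q' where "q' = q(v := v, q v := q v)"
    have "q' (q' x) = x" for x using q(1) unfolding q'_def by (metis fun_upd_apply)
    from alternating_paths[OF this distinct_ends_pairs[OF set_ys(3)]]
    obtain r where r: "\<forall>x. r (r x) = x" "\<forall>f. separates f r \<longrightarrow>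
        (\<exists>g. (\<forall>x. x \<notin> set (ends (pairs ys)) \<longrightarrow> g x = f x) \<and> separates g q'
          \<and> (\<forall>(a, b)\<in>set (pairs ys). g a \<noteq> g b))"
      by blast
    obtain f0 where "separates f0 r" using ex_separating r(1) by blast
    then obtain f1 where f1: "separates f1 q'" "\<forall>(a, b)\<in>set (pairs ys). f1 a \<noteq> f1 b" using r(2) by blast
    \<comment> \<open>\<open>v\<close> gets the opposite of its neighbour \<open>ys ! 0\<close>, and
      \<open>q v\<close> the opposite of \<open>v\<close>. The update at \<open>v\<close> comes last
      so that it prevails if \<open>q v = v\<close>.\<close>
    define f where "f = f1(q v := f1 (ys ! 0), v := \<not> f1 (ys ! 0))"
    have f_ys: "f x = f1 x" if "x \<in> set ys" for x
      using that set_ys v(2) by (auto simp: f_def)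
    have "separates f q" unfolding separates_def
    proof (intro allI impI)
      fix x assume x: "q x \<noteq> x"
      show "f (q x) \<noteq> f x"
      proof (cases "x = v \<or> x = q v")
        case True
        thus ?thesis using x q(1) by (auto simp: f_def)
      next
        case False
        hence "q x \<noteq> v" "q x \<noteq> q v" using q(1) by metis+
        moreover have "q' x = q x" using False by (simp add: q'_def)
        hence "f1 (q x) \<noteq> f1 x" using f1(1) x unfolding separates_def by metis
        ultimately show ?thesis using False by (simp add: f_def)
      qed
    qed
    then obtain g where g: "\<And>x. x \<notin> set (ends ms) \<Longrightarrow> g x = f x" "separates g p" "\<forall>(a, b)\<in>set ms. g a \<noteq> g b"
      using q(2) by blast
    have g_ys: "g x = f1 x" if "x \<in> set ys" for x
      using that g(1) not_ms set_ys(1) f_ys by auto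
    have "g v = (\<not> f1 (ys ! 0))" using g(1) not_ms[OF v(1)] by (simp add: f_def)
    hence gv: "g v \<noteq> g (ys ! 0)" using g_ys[OF y0] by simp
    have g_pairs: "\<forall>(a, b)\<in>set (pairs ys). g a \<noteq> g b"
    proof clarify
      fix a b assume ab: "(a, b) \<in> set (pairs ys)" "g a = g b"
      hence "a \<in> set (ends (pairs ys))" "b \<in> set (ends (pairs ys))"
        by (auto simp: ends_def intro!: bexI[of _ "(a, b)"])
      hence "g a = f1 a" "g b = f1 b" using g_ys set_ends_pairs[of ys] by blast+
      thus False using ab f1(2) by auto
    qed
    have "\<not> (g u = g y \<and> g u = g z)" if uyz: "E u y" "E u z" "y \<noteq> z" for u y z
    proof -
      obtain us where us: "us \<in> set Ls" "u \<in> set us" using in_Ls[OF uyz(1)] by blast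
      show ?thesis
      proof (cases "bad us")
        case False
        thus ?thesis using good[OF g(3) us(1) False us(2) uyz] by blast
      next
        case True
        hence "u \<in> set xs" using unique us xs by blast
        then consider "u = v" | "u \<in> set ys" using set_ys by auto
        thus ?thesis
        proof cases
          case 1
          thus ?thesis using neighbour_differs[OF edge_v, of g] gv uyz by auto
        next
          case 2
          then obtain i where i: "i < length ys" "u = ys ! i" by (auto simp: in_set_conv_nth)
          \<comment> \<open>The length of \<open>ys\<close> is even, so its last index is odd and
            its last entry has a partner.\<close>
          moreover have "Suc i < length ys \<or> odd i"
          proof (cases "Suc i = length ys")
            case True
            hence "even (Suc i)" using len_ys n by simp
            thus ?thesis by simp
          qed (use i in simp)
          ultimately show ?thesis using paired_differs[OF edge_ys g_pairs, of i] uyz by auto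
        qed
      qed
    qed
    thus ?thesis using g(2) by blast
  qed
qed

theorem colouring_one_long_odd_cycle:
  assumes Y: "\<forall>j<q. Y j \<subseteq> V \<and> card (Y j) = 4"
    and disj: "\<forall>i<q. \<forall>j<q. i \<noteq> j \<longrightarrow> Y i \<inter> Y j = {}"
    and few: "card {C. is_cycle_component V E C \<and> odd (card C) \<and> card C > 3} \<le> 1"
  shows "\<exists>c. proper_colouring V (glue_K4 E q Y) 4 c"
proof -
  have "\<exists>l. j < q \<longrightarrow> distinct l \<and> set l = Y j \<and> length l = 4" for j
    using finite_distinct_list[of "Y j"] Y by (metis card.infinite distinct_card zero_neq_numeral)
  then obtain l where l: "\<And>j. j < q \<Longrightarrow> distinct (l j) \<and> set (l j) = Y j \<and> length (l j) = 4" by metis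
  have elems: "x \<in> Y j \<longleftrightarrow> x = l j ! 0 \<or> x = l j ! 1 \<or> x = l j ! 2 \<or> x = l j ! 3" if "j < q" for x j
  proof -
    have "x \<in> Y j \<longleftrightarrow> (\<exists>i<4. x = l j ! i)" using l[OF that] by (metis in_set_conv_nth)
    thus ?thesis by (auto simp: less_Suc_eq eval_nat_numeral)
  qed
  have dist: "l j ! a \<noteq> l j ! b" if "j < q" "a < 4" "b < 4" "a \<noteq> b" for j a b
    using l[OF that(1)] that by (simp add: nth_eq_iff_index_eq)
  have same: "i = j" if "x \<in> Y i" "x \<in> Y j" "i < q" "j < q" for x i j using disj that by blast
  \<comment> \<open>Separating these two pairs splits each K4 evenly between the classes of
    \<open>f\<close>.\<close>
  define P where "P x y \<longleftrightarrow> (\<exists>j<q. (x, y) \<in> {(l j ! 0, l j ! 1), (l j ! 1, l j ! 0),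
    (l j ! 2, l j ! 3), (l j ! 3, l j ! 2)})" for x y
  have "\<exists>p. (\<forall>x. p (p x) = x) \<and> (\<forall>x y. P x y \<longrightarrow> p x = y) \<and> (\<forall>x. p x \<noteq> x \<longrightarrow> P x (p x))"
  proof (rule ex_involution)
    show "P x y \<Longrightarrow> P y x" for x y by (auto simp: P_def)
    fix x y z assume "P x y" "P x z"
    then obtain i j where i: "i < q" "(x, y) \<in> {(l i ! 0, l i ! 1), (l i ! 1, l i ! 0), (l i ! 2, l i ! 3), (l i ! 3, l i ! 2)}"
      and j: "j < q" "(x, z) \<in> {(l j ! 0, l j ! 1), (l j ! 1, l j ! 0), (l j ! 2, l j ! 3), (l j ! 3, l j ! 2)}"
      unfolding P_def by blast
    have "i = j" using same[of x i j] i j by (auto simp: elems)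
    thus "y = z" using i j dist[OF i(1), of 0 1] dist[OF i(1), of 0 2] dist[OF i(1), of 0 3]
        dist[OF i(1), of 1 2] dist[OF i(1), of 1 3] dist[OF i(1), of 2 3] by auto
  qed
  then obtain p where p: "\<And>x. p (p x) = x" "\<And>x y. P x y \<Longrightarrow> p x = y" by blast
  obtain f where f: "separates f p" "\<And>v y z. E v y \<Longrightarrow> E v z \<Longrightarrow> y \<noteq> z \<Longrightarrow> \<not> (f v = f y \<and> f v = f z)"
    using alternating_colouring[OF p(1) few] by blast
  have bal: "f (l j ! 0) \<noteq> f (l j ! 1)" "f (l j ! 2) \<noteq> f (l j ! 3)" if "j < q" for j
  proof -
    have "p (l j ! 0) = l j ! 1" "p (l j ! 2) = l j ! 3" using that by (auto intro!: p(2) simp: P_def)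
    thus "f (l j ! 0) \<noteq> f (l j ! 1)" "f (l j ! 2) \<noteq> f (l j ! 3)"
      using f(1) dist[OF that, of 0 1] dist[OF that, of 2 3] unfolding separates_def by auto metis+
  qed
  define R where "R x y \<longleftrightarrow> E x y \<and> f x = f y" for x y
  have "\<exists>r. (\<forall>x. r (r x) = x) \<and> (\<forall>x y. R x y \<longrightarrow> r x = y) \<and> (\<forall>x. r x \<noteq> x \<longrightarrow> R x (r x))"
  proof (rule ex_involution)
    show "R x y \<Longrightarrow> R y x" for x y using E_sym unfolding R_def by metis
    show "R x y \<Longrightarrow> R x z \<Longrightarrow> y = z" for x y z using f(2) unfolding R_def by metis
  qed
  then obtain r where r: "\<And>x. r (r x) = x" "\<And>x y. R x y \<Longrightarrow> r x = y" "\<And>x. r x \<noteq> x \<Longrightarrow> R x (r x)" by blast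
  define S where "S x y \<longleftrightarrow> x \<noteq> y \<and> f x = f y \<and> (\<exists>j<q. x \<in> Y j \<and> y \<in> Y j)" for x y
  have "\<exists>s. (\<forall>x. s (s x) = x) \<and> (\<forall>x y. S x y \<longrightarrow> s x = y) \<and> (\<forall>x. s x \<noteq> x \<longrightarrow> S x (s x))"
  proof (rule ex_involution)
    show "S x y \<Longrightarrow> S y x" for x y by (auto simp: S_def)
    fix x y z assume S: "S x y" "S x z"
    then obtain j where j: "j < q" "x \<in> Y j" "y \<in> Y j" "z \<in> Y j" using same unfolding S_def by metis
    have "f x = f y" "f x = f z" "x \<noteq> y" "x \<noteq> z" using S by (auto simp: S_def)
    thus "y = z" using j(2-4) bal[OF j(1)] unfolding elems[OF j(1)] by (elim disjE) auto
  qed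
  then obtain s where s: "\<And>x. s (s x) = x" "\<And>x y. S x y \<Longrightarrow> s x = y" by blast
  have "finite {x. r x \<noteq> x}"
    using finite_V r(3) E_V by (rule_tac finite_subset[of _ V]) (auto simp: R_def)
  then obtain g where g: "separates g s" "separates g r" using two_matchings[OF s(1) r(1)] by blast
  define c :: "'a \<Rightarrow> nat" where "c v = of_bool (f v) + 2 * of_bool (g v)" for v
  have c_eq: "c u = c v \<longleftrightarrow> f u = f v \<and> g u = g v" for u v by (auto simp: c_def)
  have "c u \<noteq> c v" if uv: "glue_K4 E q Y u v" for u v
  proof
    assume "c u = c v"
    hence eq: "f u = f v" "g u = g v" by (auto simp: c_eq)
    have ne: "u \<noteq> v" using uv E_irrefl by (auto simp: glue_K4_def)
    from uv have "R u v \<or> S u v" using eq ne by (auto simp: glue_K4_def R_def S_def)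
    hence "r u = v \<or> s u = v" using r(2) s(2) by blast
    thus False using g eq ne unfolding separates_def by metis
  qed
  moreover have "\<forall>v\<in>V. c v < 4" by (auto simp: c_def)
  ultimately show ?thesis unfolding proper_colouring_def by blast
qed

end

theorem theorem1p2:
  fixes V :: "'a set" and E :: "'a \<Rightarrow> 'a \<Rightarrow> bool"
    and q :: nat and Y :: "nat \<Rightarrow> 'a set"
  assumes "simple_graph V E"
    and "max_degree_le V E 2"
    and "\<forall>j<q. Y j \<subseteq> V \<and> card (Y j) = 4"
    and "\<forall>i<q. \<forall>j<q. i \<noteq> j \<longrightarrow> Y i \<inter> Y j = {}"
    and "card {C. is_cycle_component V E C \<and> odd (card C) \<and> card C > 3} \<le> 1
         \<or> card (triangles V E) \<le> 3"
  shows "chromatic_number V (glue_K4 E q Y) \<le> 4"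
proof -
  interpret degree_two_graph V E using assms(1,2) by unfold_locales
  have "\<exists>c. proper_colouring V (glue_K4 E q Y) 4 c"
    using assms(5) colouring_one_long_odd_cycle[OF assms(3,4)] colouring_few_triangles[OF assms(3,4)]
    by blast
  thus ?thesis unfolding chromatic_number_def by (rule Least_le)
qed

end
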